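(* If $G$ is a Meyniel graph and $\mathcal{Q}$ is any pre-co-coloring of $G$, then the co-contracted graph $G^{\mathcal{Q}}$ is an Artemis graph.
   Context: All graphs are finite and simple. A pre-co-coloring of $G$ is a collection $\mathcal{Q}=\{C_1,\ldots,C_m\}$ of pairwise disjoint cliques of $G$. The co-contracted graph $G^{\mathcal{Q}}$ is obtained from $G$ by contracting each $C_j$ into a single vertex $c_j$, where a vertex of $V(G)\setminus(C_1\cup\cdots\cup C_m)$ is adjacent to $c_j$ if and only if it is adjacent in $G$ to every vertex of $C_j$, there is no edge between any two $c_j$'s, and other adjacencies are as in $G$. A hole is a chordless cycle of length at least $4$; an antihole is the complement of a hole. A house is a cycle $p_1,\ldots,p_k$ of length $k\ge 5$ whose only chord is $p_1p_3$. A Meyniel graph is a graph in which every odd cycle has at least two chords; equivalently, a graph with no odd hole and no house as an induced subgraph. A prism is a graph formed by three vertex-disjoint chordless paths $u_0$-$\cdots$-$u_r$, $v_0$-$\cdots$-$v_s$, $w_0$-$\cdots$-$w_t$ with $r,s,t\ge 1$, such that $\{u_0,v_0,w_0\}$ and $\{u_r,v_s,w_t\}$ are cliques and there are no other edges between the three paths. An Artemis graph is a graph containing no odd hole, no antihole on at least five vertices, and no prism, as induced subgraphs. *)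

theory Defs
  imports "Graph_Theory.Graph_Theory" "HOL-Library.Disjoint_Sets"
begin

text \<open>
  Finite simple graphs are the \<^locale>\<open>pair_graph\<close>s of the library: an undirected edge \<open>uv\<close> is
  represented by the two arcs \<open>(u, v)\<close> and \<open>(v, u)\<close>. Cycles and paths are given by
  their vertex sequences.
\<close>

definition cycle_arcs :: "'a list \<Rightarrow> ('a \<times> 'a) set" where
  "cycle_arcs p = set (vwalk_arcs (p @ [hd p]))"

definition graph_cycle :: "'a pair_pre_digraph \<Rightarrow> 'a list \<Rightarrow> bool" where
  "graph_cycle G p \<longleftrightarrow>
     3 \<le> length p \<and> distinct p \<and> set p \<subseteq> pverts G \<and> cycle_arcs p \<subseteq> parcs G"

definition chords :: "'a pair_pre_digraph \<Rightarrow> 'a list \<Rightarrow> 'a set set" where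
  "chords G p = {{u, v} | u v. u \<in> set p \<and> v \<in> set p \<and>
     (u, v) \<in> parcs G \<and> (u, v) \<notin> cycle_arcs p \<and> (v, u) \<notin> cycle_arcs p}"

definition complement_graph :: "'a pair_pre_digraph \<Rightarrow> 'a pair_pre_digraph" where
  "complement_graph G = \<lparr> pverts = pverts G,
     parcs = {(u, v). u \<in> pverts G \<and> v \<in> pverts G \<and> u \<noteq> v \<and> (u, v) \<notin> parcs G} \<rparr>"

definition is_hole :: "'a pair_pre_digraph \<Rightarrow> bool" where
  "is_hole H \<longleftrightarrow> pair_graph H \<and>
     (\<exists>p. graph_cycle H p \<and> 4 \<le> length p \<and> pverts H = set p \<and> chords H p = {})"

definition is_odd_hole :: "'a pair_pre_digraph \<Rightarrow> bool" where
  "is_odd_hole H \<longleftrightarrow> is_hole H \<and> odd (card (pverts H))"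

definition is_antihole :: "'a pair_pre_digraph \<Rightarrow> bool" where
  "is_antihole H \<longleftrightarrow> pair_graph H \<and> is_hole (complement_graph H)"

definition triangle_arcs :: "'a \<Rightarrow> 'a \<Rightarrow> 'a \<Rightarrow> ('a \<times> 'a) set" where
  "triangle_arcs a b c = {(a, b), (b, c), (c, a)}"

definition prism_arcs :: "'a list \<Rightarrow> 'a list \<Rightarrow> 'a list \<Rightarrow> ('a \<times> 'a) set" where
  "prism_arcs us vs ws =
     set (vwalk_arcs us) \<union> set (vwalk_arcs vs) \<union> set (vwalk_arcs ws) \<union>
     triangle_arcs (hd us) (hd vs) (hd ws) \<union> triangle_arcs (last us) (last vs) (last ws)"

definition is_prism :: "'a pair_pre_digraph \<Rightarrow> bool" where
  "is_prism H \<longleftrightarrow> (\<exists>us vs ws.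
     2 \<le> length us \<and> 2 \<le> length vs \<and> 2 \<le> length ws \<and> distinct (us @ vs @ ws) \<and>
     pverts H = set us \<union> set vs \<union> set ws \<and>
     parcs H = prism_arcs us vs ws \<union> (prism_arcs us vs ws)\<inverse>)"

definition contains_induced ::
    "('a pair_pre_digraph \<Rightarrow> bool) \<Rightarrow> 'a pair_pre_digraph \<Rightarrow> bool" where
  "contains_induced P G \<longleftrightarrow> (\<exists>H. induced_subgraph (with_proj H) (with_proj G) \<and> P H)"

text \<open>Triangles have no chords; as usual, the defining condition only concerns odd cycles of
  length at least five.\<close>

definition meyniel :: "'a pair_pre_digraph \<Rightarrow> bool" where
  "meyniel G \<longleftrightarrow> pair_graph G \<and>
     (\<forall>p. graph_cycle G p \<and> odd (length p) \<and> 5 \<le> length p \<longrightarrow> 2 \<le> card (chords G p))"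

definition artemis :: "'a pair_pre_digraph \<Rightarrow> bool" where
  "artemis G \<longleftrightarrow> pair_graph G \<and>
     \<not> contains_induced is_odd_hole G \<and>
     \<not> contains_induced (\<lambda>H. is_antihole H \<and> 5 \<le> card (pverts H)) G \<and>
     \<not> contains_induced is_prism G"

definition clique :: "'a pair_pre_digraph \<Rightarrow> 'a set \<Rightarrow> bool" where
  "clique G C \<longleftrightarrow> C \<subseteq> pverts G \<and> (\<forall>u\<in>C. \<forall>v\<in>C. u \<noteq> v \<longrightarrow> (u, v) \<in> parcs G)"

definition pre_co_coloring :: "'a pair_pre_digraph \<Rightarrow> 'a set set \<Rightarrow> bool" where
  "pre_co_coloring G Q \<longleftrightarrow> (\<forall>C\<in>Q. C \<noteq> {} \<and> clique G C) \<and> disjoint Q"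

text \<open>\<open>Inl v\<close> is an uncontracted vertex \<open>v\<close>; \<open>Inr C\<close> is the vertex into which the clique
  \<open>C\<close> is contracted.\<close>

definition co_contract :: "'a pair_pre_digraph \<Rightarrow> 'a set set \<Rightarrow> ('a + 'a set) pair_pre_digraph" where
  "co_contract G Q = \<lparr>
     pverts = Inl ` (pverts G - \<Union>Q) \<union> Inr ` Q,
     parcs =
       {(Inl u, Inl v) | u v. u \<in> pverts G - \<Union>Q \<and> v \<in> pverts G - \<Union>Q \<and> (u, v) \<in> parcs G} \<union>
       {(Inl u, Inr C) | u C. u \<in> pverts G - \<Union>Q \<and> C \<in> Q \<and> (\<forall>x\<in>C. (u, x) \<in> parcs G)} \<union>
       {(Inr C, Inl u) | u C. u \<in> pverts G - \<Union>Q \<and> C \<in> Q \<and> (\<forall>x\<in>C. (u, x) \<in> parcs G)} \<rparr>"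

end

theory Submission
  imports Defs
begin

text \<open>
  Fix the Meyniel graph and put all vertices that any co-contraction could have into one graph:
  real vertices, and a contracted vertex for every finite set \<open>C\<close>, adjacent to the real vertices
  complete to \<open>C\<close>; contracted vertices are pairwise nonadjacent. Every co-contracted graph is induced
  in it. The gain is freedom: a contracted \<open>C\<close> in a bad configuration may be replaced by a contracted
  subset, by two contracted halves at once, or by one of its elements as a real vertex.

  In a shortest odd hole, with contracted sets as small as possible, splitting \<open>C\<close> into two halves
  and comparing the parities of the gaps between their neighbours yields a shorter odd hole, up to
  one exceptional shape; so contracted sets are singletons. The only remaining deviation from the
  Meyniel graph are edges between contracted singletons, and a parity argument turns such an edge
  into a chordless cycle with a roof over one of its edges, which is a house.

  In a smallest prism, a vertex that dominates a prism vertex and has further neighbours must see two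
  vertices of the opposite triangle: otherwise there is a smaller prism, or a vertex joined to a
  triangle by three paths, which contains an odd hole. This again forces singletons and leaves a house.
  Antiholes on at least seven vertices contain five consecutive real vertices, which form a house.
\<close>

text \<open>Shrinking a contracted set only enlarges its neighbourhood, and the neighbours of
  \<open>Inr (B \<union> D)\<close> are exactly the common neighbours of \<open>Inr B\<close> and
  \<open>Inr D\<close>. So if \<open>C\<close> is chosen smallest, each proper subset sees some
  further vertex of the configuration, while two parts with union \<open>C\<close> share no further
  one. The parity arguments live on this tension between two nonadjacent vertices. The obstacle is
  that contracted vertices are nonadjacent even when their elements are adjacent. A bad
  configuration of contracted singletons therefore need not be one of the Meyniel graph; edges
  between the elements have to be excluded separately, both for odd holes and for prisms. The
  exceptional shape for odd holes consists of two parts of \<open>h 0\<close> that see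
  \<open>h 1, h 2, h (n - 1)\<close> and \<open>h 1, h (n - 2), h (n - 1)\<close>. It survives
  because each part shortcuts the hole by one vertex and so changes its parity. Odd holes come
  before prisms, since the prism argument relies on their absence throughout.\<close>

section \<open>Induced paths and odd holes\<close>

definition ipath :: "('v \<Rightarrow> 'v \<Rightarrow> bool) \<Rightarrow> (int \<Rightarrow> 'v) \<Rightarrow> int \<Rightarrow> bool" where
  "ipath A f l \<longleftrightarrow> (\<forall>i j. 0 \<le> i \<and> i < j \<and> j < l \<longrightarrow> (A (f i) (f j) \<longleftrightarrow> j = i + 1))"

text \<open>The hole has \<open>l + 1\<close> vertices: \<open>z\<close> and the path \<open>f 0, \<dots>, f (l - 1)\<close>. Neither here nor for
  prisms below is distinctness required: it follows from the prescribed adjacencies.\<close>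

definition odd_hole :: "('v \<Rightarrow> 'v \<Rightarrow> bool) \<Rightarrow> 'v \<Rightarrow> (int \<Rightarrow> 'v) \<Rightarrow> int \<Rightarrow> bool" where
  "odd_hole A z f l \<longleftrightarrow> ipath A f l \<and> even l \<and> 4 \<le> l \<and>
     (\<forall>i. 0 \<le> i \<and> i < l \<longrightarrow> (A z (f i) \<longleftrightarrow> i = 0 \<or> i = l - 1))"

text \<open>With the order of a shortest odd hole for \<open>n\<close> this is minimality; demanded
  for every \<open>n\<close> it says that there are no odd holes. Lemmas stated with it serve both
  uses.\<close>

definition odd_holes_ge :: "('v \<Rightarrow> 'v \<Rightarrow> bool) \<Rightarrow> int \<Rightarrow> bool" where
  "odd_holes_ge A n \<longleftrightarrow> (\<forall>z f l. odd_hole A z f l \<longrightarrow> n \<le> l + 1)"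

text \<open>The hole leaves \<open>z\<close> along \<open>p\<close>, crosses the only edge between
  the two paths and returns along \<open>q\<close>, which the witness therefore traverses
  backwards.\<close>

lemma odd_hole_two_paths:
  assumes sym: "symp A" and n: "odd_holes_ge A n"
    and p: "ipath A p a" and q: "ipath A q b" and ab: "1 \<le> a" "1 \<le> b" "even (a + b)" "4 \<le> a + b"
    and zp: "\<And>i. 0 \<le> i \<Longrightarrow> i < a \<Longrightarrow> A z (p i) \<longleftrightarrow> i = 0"
    and zq: "\<And>i. 0 \<le> i \<Longrightarrow> i < b \<Longrightarrow> A z (q i) \<longleftrightarrow> i = 0"
    and pq: "\<And>i j. 0 \<le> i \<Longrightarrow> i < a \<Longrightarrow> 0 \<le> j \<Longrightarrow> j < b \<Longrightarrow> A (p i) (q j) \<longleftrightarrow> i = a - 1 \<and> j = b - 1"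
  shows "n \<le> a + b + 1"
proof -
  define f where "f i = (if i < a then p i else q (a + b - 1 - i))" for i
  have "ipath A f (a + b)"
    unfolding ipath_def
  proof (intro allI impI)
    fix i j assume ij: "0 \<le> i \<and> i < j \<and> j < a + b"
    consider "j < a" | "i < a" "a \<le> j" | "a \<le> i" by linarith
    then show "A (f i) (f j) \<longleftrightarrow> j = i + 1"
    proof cases
      case 1 then show ?thesis using p ij by (auto simp: f_def ipath_def)
    next
      case 2 then show ?thesis using pq[of i "a + b - 1 - j"] ij by (auto simp: f_def)
    next
      case 3
      have "A (q (a + b - 1 - j)) (q (a + b - 1 - i)) \<longleftrightarrow> a + b - 1 - i = a + b - 1 - j + 1"
        using q ij 3 unfolding ipath_def by auto
      then show ?thesis using 3 ij sym by (auto simp: f_def dest: sympD)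
    qed
  qed
  moreover have "A z (f i) \<longleftrightarrow> i = 0 \<or> i = a + b - 1" if "0 \<le> i" "i < a + b" for i
    using zp[of i] zq[of "a + b - 1 - i"] that ab by (auto simp: f_def)
  ultimately have "odd_hole A z f (a + b)" using ab by (auto simp: odd_hole_def)
  then show ?thesis using n by (auto simp: odd_holes_ge_def)
qed

text \<open>Here the paths do not touch and \<open>y\<close> closes the cycle; appending
  \<open>y\<close> to \<open>p\<close> gives the previous situation. In the applications
  \<open>y\<close> and \<open>z\<close> are contracted sets.\<close>

lemma odd_hole_two_vertices:
  assumes sym: "symp A" and n: "odd_holes_ge A n"
    and p: "ipath A p a" and q: "ipath A q b" and ab: "1 \<le> a" "1 \<le> b" "odd (a + b)" "3 \<le> a + b"
    and yz: "\<not> A y z"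
    and zp: "\<And>i. 0 \<le> i \<Longrightarrow> i < a \<Longrightarrow> A z (p i) \<longleftrightarrow> i = 0"
    and zq: "\<And>i. 0 \<le> i \<Longrightarrow> i < b \<Longrightarrow> A z (q i) \<longleftrightarrow> i = 0"
    and yp: "\<And>i. 0 \<le> i \<Longrightarrow> i < a \<Longrightarrow> A y (p i) \<longleftrightarrow> i = a - 1"
    and yq: "\<And>i. 0 \<le> i \<Longrightarrow> i < b \<Longrightarrow> A y (q i) \<longleftrightarrow> i = b - 1"
    and pq: "\<And>i j. 0 \<le> i \<Longrightarrow> i < a \<Longrightarrow> 0 \<le> j \<Longrightarrow> j < b \<Longrightarrow> \<not> A (p i) (q j)"
  shows "n \<le> a + b + 2"
proof -
  define f where "f i = (if i < a then p i else y)" for i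
  have "n \<le> (a + 1) + b + 1"
  proof (rule odd_hole_two_paths[OF sym n, where p = f and q = q and z = z])
    show "ipath A f (a + 1)"
      unfolding ipath_def
    proof (intro allI impI)
      fix i j assume ij: "0 \<le> i \<and> i < j \<and> j < a + 1"
      show "A (f i) (f j) \<longleftrightarrow> j = i + 1"
      proof (cases "j < a")
        case True then show ?thesis using p ij by (auto simp: f_def ipath_def)
      next
        case False
        then show ?thesis using ij yp[of i] sym by (auto simp: f_def dest: sympD)
      qed
    qed
    show "A z (f i) \<longleftrightarrow> i = 0" if "0 \<le> i" "i < a + 1" for i
      using that zp[of i] yz sym ab by (auto simp: f_def dest: sympD)
    show "A (f i) (q j) \<longleftrightarrow> i = a + 1 - 1 \<and> j = b - 1" if "0 \<le> i" "i < a + 1" "0 \<le> j" "j < b" for i j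
      using that pq[of i j] yq[of j] by (auto simp: f_def)
  qed (use q ab zq in auto)
  then show ?thesis by simp
qed

section \<open>Meyniel graphs as relations, and the house\<close>

text \<open>The only chord that \<open>two_chords\<close> tolerates joins the two neighbours of the
  last vertex of \<open>p\<close>. Thus odd holes (chord absent) and houses on an odd cycle (chord
  present, last vertex as roof) are excluded by one statement.\<close>

locale meyniel_rel =
  fixes E :: "'a \<Rightarrow> 'a \<Rightarrow> bool"
  assumes sym: "E x y \<Longrightarrow> E y x" and irrefl: "\<not> E x x"
    and two_chords: "\<lbrakk>distinct p; odd (length p); 5 \<le> length p;
      \<And>i. Suc i < length p \<Longrightarrow> E (p ! i) (p ! Suc i); E (p ! (length p - 1)) (p ! 0);
      \<And>i j. i < j \<Longrightarrow> j < length p \<Longrightarrow> E (p ! i) (p ! j) \<Longrightarrow>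
        j = Suc i \<or> (i = 0 \<and> (j = length p - 1 \<or> j = length p - 2))\<rbrakk> \<Longrightarrow> False"
begin

text \<open>A shortest walk from \<open>b\<close> to \<open>a\<close> with interior in
  \<open>ms\<close> closes with the edge \<open>a b\<close> to a chordless cycle, of length at least
  4 by \<open>common\<close>. If its length is odd, it is an odd hole; if it is even, adding
  \<open>w\<close> gives an odd cycle with the single chord \<open>a b\<close>. As a walk suffices,
  callers need not control the chords among \<open>ms\<close>.\<close>

lemma roof:
  assumes ab: "E a b" and wa: "E w a" and wb: "E w b"
    and ne: "ms \<noteq> []" and walk: "successively E (b # ms @ [a])"
    and wm: "\<And>m. m \<in> set ms \<Longrightarrow> \<not> E w m"
    and common: "\<And>m. m \<in> set ms \<Longrightarrow> \<not> (E a m \<and> E b m)"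
  shows False
proof -
  \<comment> \<open>Three vertices are required because otherwise \<open>[b, a]\<close> would be the
    shortest walk.\<close>
  define good where "good W \<longleftrightarrow> 3 \<le> length W \<and> W ! 0 = b \<and> W ! (length W - 1) = a \<and>
     (\<forall>i. Suc i < length W \<longrightarrow> E (W ! i) (W ! Suc i)) \<and>
     (\<forall>i. 0 < i \<and> i < length W - 1 \<longrightarrow> W ! i \<in> set ms)" for W
  have g0: "good (b # ms @ [a])"
    using ne walk unfolding good_def
    by (auto simp: successively_conv_nth nth_append nth_Cons' Suc_le_eq less_Suc_eq_le neq_Nil_conv)
  define W where "W = (ARG_MIN length W. good W)"
  have gW: "good W" and min: "\<And>V. good V \<Longrightarrow> length W \<le> length V"
    using arg_min_nat_lemma[of good _ length, OF g0] by (auto simp: W_def)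
  define l where "l = length W"
  have l3: "3 \<le> l" and W0: "W ! 0 = b" and Wl: "W ! (l - 1) = a"
    and Ws: "\<And>i. Suc i < l \<Longrightarrow> E (W ! i) (W ! Suc i)"
    and Wm: "\<And>i. 0 < i \<Longrightarrow> i < l - 1 \<Longrightarrow> W ! i \<in> set ms"
    using gW by (auto simp: good_def l_def)
  \<comment> \<open>The shortcut stays good as long as an interior vertex remains; this is why the
    pair of both ends, which is the edge \<open>a b\<close>, is exempt.\<close>
  have cut: False if "i < j" "j < l" "0 < i \<or> j < l - 1" and e: "E (W ! i) (W ! j)" and "j \<noteq> Suc i" for i j
  proof -
    define V where "V = take (Suc i) W @ drop j W"
    have len: "length V = Suc i + (l - j)" using that by (simp add: V_def l_def)
    have nth: "V ! k = (if k \<le> i then W ! k else W ! (k - Suc i + j))" if "k < length V" for k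
      using that \<open>i < j\<close> \<open>j < l\<close> len by (auto simp: V_def nth_append l_def add.commute)
    have "good V" unfolding good_def
    proof (intro conjI allI impI)
      show "3 \<le> length V" using that len by auto
      show "V ! 0 = b" using nth[of 0] W0 len by auto
      show "V ! (length V - 1) = a" using nth[of "length V - 1"] Wl len that by auto
    next
      fix k assume k: "Suc k < length V"
      consider "k < i" | "k = i" | "i < k" by linarith
      then show "E (V ! k) (V ! Suc k)"
      proof cases
        case 1 then show ?thesis using nth[of k] nth[of "Suc k"] k Ws[of k] that by auto
      next
        case 2 then show ?thesis using nth[of k] nth[of "Suc k"] k e by auto
      next
        case 3
        then obtain d where d: "k = Suc (i + d)" using less_imp_Suc_add by blast
        then have "E (W ! (d + j)) (W ! Suc (d + j))" using k len that by (intro Ws) auto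
        then show ?thesis using nth[of k] nth[of "Suc k"] k d by auto
      qed
    next
      fix k assume "0 < k \<and> k < length V - 1"
      then show "V ! k \<in> set ms" using nth[of k] Wm[of k] Wm[of "k - Suc i + j"] that len by auto
    qed
    from min[OF this] show False using len that l_def by auto
  qed
  \<comment> \<open>A repeated vertex yields a shortcut from the predecessor of its first
    occurrence. The ends do not recur inside, since \<open>w\<close> sees them but nothing in
    \<open>ms\<close>.\<close>
  have dist: "W ! i \<noteq> W ! j" if "i < j" "j < l" for i j
  proof
    assume eq: "W ! i = W ! j"
    show False
    proof (cases "j = l - 1")
      case True
      then have "W ! i = a" using eq Wl by simp
      then have "i = 0" using Wm[of i] wm wa that True by (metis gr0I)
      then show False using W0 \<open>W ! i = a\<close> ab irrefl by auto
    next
      case False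
      then have "W ! j \<in> set ms" using Wm[of j] that by linarith
      then have "i \<noteq> 0" using eq W0 wm wb by metis
      then obtain k where k: "i = Suc k" using not0_implies_Suc by blast
      then have "E (W ! k) (W ! j)" using Ws[of k] eq that by auto
      have "j < l - 1" using that False by linarith
      then show False using cut[of k j] k that \<open>E (W ! k) (W ! j)\<close> by auto
    qed
  qed
  have l4: "4 \<le> l"
  proof (rule ccontr)
    assume "\<not> 4 \<le> l"
    then have l: "l = 3" using l3 by simp
    have "E b (W ! 1)" "E (W ! 1) a" "W ! 1 \<in> set ms"
      using Ws[of 0] Ws[of 1] Wm[of 1] W0 Wl l by (auto simp: numeral_2_eq_2)
    then show False using common sym by blast
  qed
  have chordless: "j = Suc i \<or> (i = 0 \<and> j = l - 1)" if "i < j" "j < l" "E (W ! i) (W ! j)" for i j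
  proof (rule ccontr)
    assume "\<not> (j = Suc i \<or> (i = 0 \<and> j = l - 1))"
    then have "j \<noteq> Suc i" "0 < i \<or> j < l - 1" using that by linarith+
    then show False using cut[of i j] that by blast
  qed
  have dW: "distinct W" using dist unfolding distinct_conv_nth l_def by (metis linorder_neqE_nat)
  show False
  proof (cases "odd l")
    case True
    then have "5 \<le> l" using l4 by presburger
    show False
    proof (rule two_chords[of W])
      show "E (W ! (length W - 1)) (W ! 0)" using W0 Wl ab by (simp add: l_def)
      show "j = Suc i \<or> i = 0 \<and> (j = length W - 1 \<or> j = length W - 2)"
        if "i < j" "j < length W" "E (W ! i) (W ! j)" for i j
        using chordless[of i j] that by (auto simp: l_def)
    qed (use dW Ws True \<open>5 \<le> l\<close> in \<open>auto simp: l_def\<close>)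
  next
    case False
    have wW: "E w (W ! i) \<longleftrightarrow> i = 0 \<or> i = l - 1" if "i < l" for i
      using Wm[of i] wm wa wb W0 Wl that by (cases "0 < i \<and> i < l - 1") auto
    \<comment> \<open>As \<open>w\<close> does not see itself, it might still occur in
      \<open>ms\<close>. Then both its neighbours on \<open>W\<close> would be ends, leaving only
      three vertices.\<close>
    have wnot: "w \<notin> set W"
    proof
      assume "w \<in> set W"
      then obtain i where i: "i < l" "W ! i = w" by (auto simp: in_set_conv_nth l_def)
      then have "i \<noteq> 0" "i \<noteq> l - 1" using wa wb W0 Wl irrefl by metis+
      then have "0 < i" "Suc i < l" using i by linarith+
      moreover have "E w (W ! (i - 1))" "E w (W ! Suc i)"
        using Ws[of "i - 1"] Ws[of i] calculation i sym by auto
      ultimately have "i - 1 = 0 \<or> i - 1 = l - 1" "Suc i = l - 1"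
        using wW[of "i - 1"] wW[of "Suc i"] by auto
      then show False using l4 \<open>0 < i\<close> by linarith
    qed
    show False
    proof (rule two_chords[of "W @ [w]"])
      show "distinct (W @ [w])" using dW wnot by auto
      show "odd (length (W @ [w]))" "5 \<le> length (W @ [w])" using False l4 by (auto simp: l_def)
      show "E ((W @ [w]) ! i) ((W @ [w]) ! Suc i)" if "Suc i < length (W @ [w])" for i
      proof (cases "Suc i < l")
        case True
        then show ?thesis using Ws[of i] by (simp add: nth_append l_def)
      next
        case False
        then have "i = l - 1" "Suc i = l" using that by (auto simp: l_def)
        then show ?thesis using Wl sym[OF wa] l4 by (simp add: nth_append flip: l_def)
      qed
      show "E ((W @ [w]) ! (length (W @ [w]) - 1)) ((W @ [w]) ! 0)"
        using wb W0 l4 by (auto simp: nth_append l_def[symmetric])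
      show "j = Suc i \<or> i = 0 \<and> (j = length (W @ [w]) - 1 \<or> j = length (W @ [w]) - 2)"
        if "i < j" "j < length (W @ [w])" "E ((W @ [w]) ! i) ((W @ [w]) ! j)" for i j
      proof (cases "j < l")
        case True
        then show ?thesis using chordless[of i j] that by (auto simp: nth_append l_def)
      next
        case False
        then have "j = l" using that by (auto simp: l_def)
        then show ?thesis using wW[of i] sym that by (auto simp: nth_append simp flip: l_def)
      qed
    qed
  qed
qed

end

section \<open>Extremal elements and parity in integer intervals\<close>

lemma int_last_true:
  fixes a b :: int
  assumes "P a" "a \<le> b"
  obtains m where "P m" "a \<le> m" "m \<le> b" "\<And>i. m < i \<Longrightarrow> i \<le> b \<Longrightarrow> \<not> P i"
proof -
  define M where "M = {i \<in> {a..b}. P i}"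
  have "M \<subseteq> {a..b}" "a \<in> M" using assms by (auto simp: M_def)
  then have "finite M" "M \<noteq> {}" using finite_subset by auto
  then have "Max M \<in> M" "\<And>i. i \<in> M \<Longrightarrow> i \<le> Max M" by (auto intro: Max_in)
  moreover define m where "m = Max M"
  ultimately have m: "m \<in> M" "\<And>i. i \<in> M \<Longrightarrow> i \<le> m" by auto
  have "\<not> P i" if "m < i" "i \<le> b" for i using m(1) m(2)[of i] that by (auto simp: M_def)
  then show ?thesis using that[of m] m(1) by (auto simp: M_def)
qed

lemma int_first_true:
  fixes a b :: int
  assumes "P b" "a \<le> b"
  obtains m where "P m" "a \<le> m" "m \<le> b" "\<And>i. a \<le> i \<Longrightarrow> i < m \<Longrightarrow> \<not> P i"
proof -
  obtain m where "P (- m)" "- b \<le> m" "m \<le> - a" "\<And>i. m < i \<Longrightarrow> i \<le> - a \<Longrightarrow> \<not> P (- i)"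
    using int_last_true[of "\<lambda>i. P (- i)" "- b" "- a"] assms by auto
  then show ?thesis using that[of "- m"] by (metis minus_le_iff minus_less_iff minus_minus)
qed

text \<open>\<open>S\<close> will be the set of indices of the neighbours of a vertex on a shortest
  odd hole; there \<open>gap\<close> holds because consecutive neighbours at odd distance above 1
  close a shorter odd hole. The window from \<open>p\<close> to \<open>q\<close> cuts off places
  where adjacent pairs may occur.\<close>

lemma even_diff_if_no_adjacent:
  fixes S :: "int set"
  assumes gap: "\<And>s t. s \<in> S \<Longrightarrow> t \<in> S \<Longrightarrow> p \<le> s \<Longrightarrow> t \<le> q \<Longrightarrow> s < t \<Longrightarrow>
      (\<And>i. s < i \<Longrightarrow> i < t \<Longrightarrow> i \<notin> S) \<Longrightarrow> odd (t - s) \<Longrightarrow> t = s + 1"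
    and adj: "\<And>s. s \<in> S \<Longrightarrow> s + 1 \<in> S \<Longrightarrow> p \<le> s \<Longrightarrow> s < q \<Longrightarrow> False"
    and "s \<in> S" "t \<in> S" "p \<le> s" "t \<le> q" "s \<le> t"
  shows "even (t - s)"
  using assms(3-)
proof (induction "nat (t - s)" arbitrary: s t rule: less_induct)
  case less
  show ?case
  proof (cases "\<exists>i. s < i \<and> i < t \<and> i \<in> S")
    case True
    then obtain i where i: "s < i" "i < t" "i \<in> S" by auto
    then have "even (i - s)" "even (t - i)" using less by auto
    then show ?thesis by presburger
  next
    case False
    show ?thesis
    proof (rule ccontr)
      assume o: "odd (t - s)"
      then have "s < t" using less.prems by (cases "s = t") auto
      then have "t = s + 1" using gap[of s t] less.prems o False by auto
      then show False using adj[of s] less.prems by auto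
    qed
  qed
qed

section \<open>Two nonadjacent vertices attached to a shortest odd hole\<close>

text \<open>Nothing is assumed about \<open>h 0\<close>, so that other vertices can take its place:
  \<open>y\<close> and \<open>z\<close> below are two parts of a contracted \<open>h 0\<close>, and
  both inherit the neighbours \<open>h 1\<close> and \<open>h (n - 1)\<close>.\<close>

locale hole_path =
  fixes A :: "'v \<Rightarrow> 'v \<Rightarrow> bool" and h :: "int \<Rightarrow> 'v" and n :: int
  assumes symp: "symp A" and odd: "odd n" and n5: "5 \<le> n" and shortest: "odd_holes_ge A n"
    and path: "\<And>i j. 1 \<le> i \<Longrightarrow> i < j \<Longrightarrow> j \<le> n - 1 \<Longrightarrow> A (h i) (h j) \<longleftrightarrow> j = i + 1"
begin

lemma symA: "A x y \<longleftrightarrow> A y x" using symp by (auto dest: sympD)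

lemma segment: "1 \<le> s \<Longrightarrow> s + l \<le> n \<Longrightarrow> ipath A (\<lambda>i. h (s + i)) l"
  unfolding ipath_def using path by auto

lemma segment_rev: "l \<le> u \<Longrightarrow> u \<le> n - 1 \<Longrightarrow> ipath A (\<lambda>i. h (u - i)) l"
  unfolding ipath_def
proof (intro allI impI)
  fix i j assume "l \<le> u" "u \<le> n - 1" "0 \<le> i \<and> i < j \<and> j < l"
  then show "A (h (u - i)) (h (u - j)) \<longleftrightarrow> j = i + 1"
    using path[of "u - j" "u - i"] symA by auto
qed

text \<open>Otherwise \<open>z\<close> and the segment form an odd hole on \<open>t - s + 2\<close>
  vertices, which is less than \<open>n\<close> unless the segment is the whole path.\<close>

lemma gap:
  assumes "1 \<le> s" "s < t" "t \<le> n - 1" "A z (h s)" "A z (h t)"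
    and "\<And>i. s < i \<Longrightarrow> i < t \<Longrightarrow> \<not> A z (h i)" and "odd (t - s)" and "\<not> (s = 1 \<and> t = n - 1)"
  shows "t = s + 1"
proof (rule ccontr)
  assume "t \<noteq> s + 1"
  then have "4 \<le> t - s + 1" using assms by presburger
  moreover have "ipath A (\<lambda>i. h (s + i)) (t - s + 1)" using assms by (intro segment) auto
  moreover have "A z (h (s + i)) \<longleftrightarrow> i = 0 \<or> i = t - s" if "0 \<le> i" "i \<le> t - s" for i
    using assms(4,5) assms(6)[of "s + i"] that by (cases "0 < i \<and> i < t - s") auto
  ultimately have "odd_hole A z (\<lambda>i. h (s + i)) (t - s + 1)"
    using assms(7) unfolding odd_hole_def by auto
  then have "n \<le> t - s + 2" using shortest unfolding odd_holes_ge_def by fastforce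
  then show False using assms by linarith
qed

lemma mirror: "hole_path A (\<lambda>i. h (n - i)) n"
proof
  fix i j assume "1 \<le> i" "i < j" "j \<le> n - 1"
  then show "A (h (n - i)) (h (n - j)) \<longleftrightarrow> j = i + 1"
    using path[of "n - j" "n - i"] symA by auto
qed (use symp odd n5 shortest in auto)

text \<open>The odd hole is \<open>z\<close>, \<open>h s\<close>, ..., \<open>h u\<close>,
  \<open>y\<close>, \<open>h w\<close> with \<open>u - s + 4\<close> vertices, where
  \<open>h w\<close> is a common neighbour that does not touch the segment. The candidates for
  \<open>w\<close> are \<open>n - 1\<close> and 1; in the exceptional case both are next to the
  segment.\<close>

lemma split_gap_left:
  assumes nz: "\<not> A y z"
    and ends: "A z (h 1)" "A z (h (n - 1))" "A y (h 1)" "A y (h (n - 1))"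
    and st: "1 \<le> s" "s < t" "t \<le> n - 1" "A z (h s)" "\<And>i. s < i \<Longrightarrow> i < t \<Longrightarrow> \<not> A z (h i)"
    and u: "s \<le> u" "u + 1 \<le> t" "A y (h u)" "A y (h (u + 1))"
      "\<And>i. s \<le> i \<Longrightarrow> i \<le> t \<Longrightarrow> A y (h i) \<Longrightarrow> i = u \<or> i = u + 1"
    and odd_us: "odd (u - s)"
  shows "s = 2 \<and> u = n - 2"
proof (rule ccontr)
  assume neg: "\<not> (s = 2 \<and> u = n - 2)"
  have s2: "2 \<le> s" using u(5)[of s] ends(3) odd_us st u by (cases "s = 1") auto
  obtain w where w: "1 \<le> w" "w \<le> n - 1" "w + 1 < s \<or> u + 1 < w" "A z (h w)" "A y (h w)"
    "u - s + 4 < n"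
  proof (cases "u \<le> n - 3")
    case True
    then show ?thesis using that[of "n - 1"] ends s2 n5 by auto
  next
    case False
    then have "u = n - 2" using u st by linarith
    then have "3 \<le> s" using neg s2 by linarith
    then show ?thesis using that[of 1] ends \<open>u = n - 2\<close> n5 by auto
  qed
  have "n \<le> (u - s + 1) + 1 + 2"
  proof (rule odd_hole_two_vertices[OF symp shortest, where z = z and y = y
        and p = "\<lambda>i. h (s + i)" and q = "\<lambda>_. h w"])
    show "ipath A (\<lambda>i. h (s + i)) (u - s + 1)" using s2 u st by (intro segment) auto
    show "ipath A (\<lambda>_. h w) 1" by (auto simp: ipath_def)
    show "odd (u - s + 1 + 1)" using odd_us by simp
    show "A z (h (s + i)) \<longleftrightarrow> i = 0" if "0 \<le> i" "i < u - s + 1" for i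
      using st(5)[of "s + i"] st(4) that u by (cases "i = 0") auto
    show "A y (h (s + i)) \<longleftrightarrow> i = u - s + 1 - 1" if "0 \<le> i" "i < u - s + 1" for i
      using u(5)[of "s + i"] u(3) that u(1,2) by auto
    show "\<not> A (h (s + i)) (h w)" if "0 \<le> i" "i < u - s + 1" "0 \<le> j" "j < 1" for i j :: int
      using path[of "s + i" w] path[of w "s + i"] that w(1-3) st(1-3) u(1,2) symA[of "h w"] by auto
  next
    have "u \<noteq> s" using odd_us by auto
    then show "3 \<le> u - s + 1 + 1" using u by linarith
  qed (use u nz w in auto)
  then show False using w by linarith
qed

text \<open>A gap of odd length would be a single edge with a common neighbour other than
  \<open>h 1\<close> and \<open>h (n - 1)\<close>, so \<open>t - s\<close> is even. If
  \<open>v - u\<close> is odd and at least 3, the cycle through \<open>z\<close>, \<open>h s\<close>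
  to \<open>h u\<close>, \<open>y\<close>, \<open>h v\<close> to \<open>h t\<close> is a shorter odd
  hole. If \<open>v = u + 1\<close>, exactly one of \<open>u - s\<close> and \<open>t - v\<close> is
  odd, and \<open>split_gap_left\<close> applies on that side, directly or mirrored.\<close>

lemma split_gap:
  assumes nz: "\<not> A y z"
    and ends: "A z (h 1)" "A z (h (n - 1))" "A y (h 1)" "A y (h (n - 1))"
    and common: "\<And>i. 2 \<le> i \<Longrightarrow> i \<le> n - 2 \<Longrightarrow> \<not> (A y (h i) \<and> A z (h i))"
    and nontriv: "2 \<le> k" "k \<le> n - 2" "A z (h k)"
    and st: "1 \<le> s" "s < t" "t \<le> n - 1" "A z (h s)" "A z (h t)" "\<And>i. s < i \<Longrightarrow> i < t \<Longrightarrow> \<not> A z (h i)"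
    and uv: "s \<le> u" "u \<le> v" "v \<le> t" "A y (h u)" "A y (h v)"
      "\<And>i. s \<le> i \<Longrightarrow> i < u \<Longrightarrow> \<not> A y (h i)" "\<And>i. v < i \<Longrightarrow> i \<le> t \<Longrightarrow> \<not> A y (h i)"
    and not_left: "\<not> (s = 2 \<and> u = n - 2)" and not_right: "\<not> (t = n - 2 \<and> v = 2)"
  shows "even (v - u)"
proof (rule ccontr)
  assume odd_vu: "odd (v - u)"
  then have "u < v" using uv(2) by (cases "u = v") auto
  have not_all: "\<not> (s = 1 \<and> t = n - 1)" using nontriv st(6)[of k] by auto
  have "even (t - s)"
  proof (rule ccontr)
    assume "odd (t - s)"
    then have "t = s + 1" using gap[of s t z] st not_all by auto
    then have "u = s" "v = s + 1" using uv(1-3) odd_vu by presburger+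
    then show False using common[of s] common[of t] uv st \<open>t = s + 1\<close> n5 by (cases "2 \<le> s") auto
  qed
  show False
  proof (cases "v = u + 1")
    case True
    have only: "i = u \<or> i = u + 1" if "s \<le> i" "i \<le> t" "A y (h i)" for i
      using uv(6)[of i] uv(7)[of i] that True by linarith
    show False
    proof (cases "odd (u - s)")
      case True
      then show False
        using split_gap_left[OF nz ends st(1-4,6), of u] uv only \<open>v = u + 1\<close> not_left by auto
    next
      case False
      interpret m: hole_path A "\<lambda>i. h (n - i)" n by (rule mirror)
      have "n - t = 2 \<and> n - v = n - 2"
      proof (rule m.split_gap_left[OF nz, where t = "n - s"])
        show "odd (n - v - (n - t))" using False \<open>even (t - s)\<close> \<open>v = u + 1\<close> by presburger
        show "\<not> A z (h (n - i))" if "n - t < i" "i < n - s" for i using st(6)[of "n - i"] that by auto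
        show "i = n - v \<or> i = n - v + 1" if "n - t \<le> i" "i \<le> n - s" "A y (h (n - i))" for i
          using only[of "n - i"] that \<open>v = u + 1\<close> by auto
      qed (use ends st uv \<open>v = u + 1\<close> in auto)
      then show False using not_right by auto
    qed
  next
    case False
    have "n \<le> (u - s + 1) + (t - v + 1) + 2"
    proof (rule odd_hole_two_vertices[OF symp shortest, where z = z and y = y
          and p = "\<lambda>i. h (s + i)" and q = "\<lambda>i. h (t - i)"])
      show "ipath A (\<lambda>i. h (s + i)) (u - s + 1)" using uv st by (intro segment) auto
      show "ipath A (\<lambda>i. h (t - i)) (t - v + 1)" using uv st by (intro segment_rev) auto
      show "odd (u - s + 1 + (t - v + 1))" using odd_vu \<open>even (t - s)\<close> by presburger
      show "3 \<le> u - s + 1 + (t - v + 1)" using odd_vu \<open>even (t - s)\<close> uv(1-3) by presburger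
      show "A z (h (s + i)) \<longleftrightarrow> i = 0" if "0 \<le> i" "i < u - s + 1" for i
        using st(6)[of "s + i"] st(4) that uv(1-3) \<open>u < v\<close> by (cases "i = 0") auto
      show "A z (h (t - i)) \<longleftrightarrow> i = 0" if "0 \<le> i" "i < t - v + 1" for i
        using st(6)[of "t - i"] st(5) that uv(1-3) \<open>u < v\<close> by (cases "i = 0") auto
      show "A y (h (s + i)) \<longleftrightarrow> i = u - s + 1 - 1" if "0 \<le> i" "i < u - s + 1" for i
        using uv(6)[of "s + i"] uv(4) that by (cases "i = u - s") auto
      show "A y (h (t - i)) \<longleftrightarrow> i = t - v + 1 - 1" if "0 \<le> i" "i < t - v + 1" for i
        using uv(7)[of "t - i"] uv(5) that by (cases "i = t - v") auto
      show "\<not> A (h (s + i)) (h (t - j))" if "0 \<le> i" "i < u - s + 1" "0 \<le> j" "j < t - v + 1" for i j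
      proof -
        have "s + i + 1 < t - j" using that False uv(1-3) odd_vu by presburger
        then show ?thesis using path[of "s + i" "t - j"] that uv(1-3) st(1-3) by auto
      qed
    qed (use uv nz in auto)
    moreover have "3 \<le> v - u" using False uv odd_vu by presburger
    moreover have "t - s \<le> n - 3" using not_all st(1-3) \<open>even (t - s)\<close> odd by presburger
    ultimately show False by linarith
  qed
qed

lemma two_nontrivial:
  assumes nz: "\<not> A y z"
    and ends: "A z (h 1)" "A z (h (n - 1))" "A y (h 1)" "A y (h (n - 1))"
    and common: "\<And>i. 2 \<le> i \<Longrightarrow> i \<le> n - 2 \<Longrightarrow> \<not> (A y (h i) \<and> A z (h i))"
    and nontriv: "2 \<le> k" "k \<le> n - 2" "A z (h k)" "2 \<le> k'" "k' \<le> n - 2" "A y (h k')"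
  obtains s u t where "1 \<le> s" "s < t" "t \<le> n - 1" "A z (h s)" "A z (h t)"
      "\<And>i. s < i \<Longrightarrow> i < t \<Longrightarrow> \<not> A z (h i)" "s \<le> u" "u < t"
      "\<And>i. s \<le> i \<Longrightarrow> i \<le> t \<Longrightarrow> A y (h i) \<longleftrightarrow> i = u \<or> i = u + 1"
      "s = 2 \<and> u = n - 2 \<or> t = n - 2 \<and> u = 1"
proof (rule ccontr)
  assume "\<not> thesis"
  note contra = this[THEN notE, OF that]
  \<comment> \<open>Moving up the neighbours \<open>t\<close> of \<open>z\<close>, the parity of the last neighbour of \<open>y\<close> up to \<open>t\<close> never
    changes, although it must between \<open>1\<close> and \<open>n - 1\<close>.\<close>
  have inv: "1 \<le> t \<Longrightarrow> t \<le> n - 1 \<Longrightarrow> A z (h t) \<Longrightarrow> 1 \<le> v \<Longrightarrow> v \<le> t \<Longrightarrow> A y (h v) \<Longrightarrow>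
    (\<And>i. v < i \<Longrightarrow> i \<le> t \<Longrightarrow> \<not> A y (h i)) \<Longrightarrow> odd v" for t v
  proof (induction "nat t" arbitrary: t v rule: less_induct)
    case less
    show ?case
    proof (cases "t = 1")
      case True then show ?thesis using less.prems by auto
    next
      case False
      then obtain s where s: "A z (h s)" "1 \<le> s" "s \<le> t - 1" "\<And>i. s < i \<Longrightarrow> i \<le> t - 1 \<Longrightarrow> \<not> A z (h i)"
        using int_last_true[of "\<lambda>i. A z (h i)" 1 "t - 1"] ends less.prems by auto
      obtain v' where v': "A y (h v')" "1 \<le> v'" "v' \<le> s" "\<And>i. v' < i \<Longrightarrow> i \<le> s \<Longrightarrow> \<not> A y (h i)"
        using int_last_true[of "\<lambda>i. A y (h i)" 1 s] ends s by auto
      have odd': "odd v'" using less.hyps[of s v'] s v' less.prems by auto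
      show ?thesis
      proof (cases "v < s")
        case True
        then have "v' = v" using v' less.prems(5,6,7) s(3) by (metis linorder_neqE order.trans less_imp_le zle_diff1_eq)
        then show ?thesis using odd' by simp
      next
        case vs: False
        obtain u where u: "A y (h u)" "s \<le> u" "u \<le> v" "\<And>i. s \<le> i \<Longrightarrow> i < u \<Longrightarrow> \<not> A y (h i)"
          using int_first_true[of "\<lambda>i. A y (h i)" v s] vs less.prems by auto
        \<comment> \<open>Unless they coincide, \<open>v'\<close> and \<open>u\<close> are
          consecutive neighbours of \<open>y\<close> on either side of \<open>s\<close>. At odd
          distance they would be adjacent, leaving no room for \<open>s\<close>; \<open>k'\<close>
          shows that they are not the two ends of the path.\<close>
        have "even (u - v')"
        proof (cases "u = s")
          case True
          then have "v' = s" using v' u by (metis order_le_less)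
          then show ?thesis using True by simp
        next
          case False
          then have "v' < s" using u(4)[of s] u(2) v'(1,3) by (cases "v' = s") auto
          have no: "\<not> A y (h i)" if "v' < i" "i < u" for i
            using v'(4)[of i] u(4)[of i] that by linarith
          show ?thesis
          proof (rule ccontr)
            assume "odd (u - v')"
            moreover have "\<not> (v' = 1 \<and> u = n - 1)" using no[of k'] nontriv by auto
            ultimately have "u = v' + 1"
              using gap[of v' u y] v' u no less.prems \<open>v' < s\<close> by auto
            then show False using \<open>v' < s\<close> u(2) False by linarith
          qed
        qed
        moreover have "even (v - u)"
        proof (cases "s = 2 \<and> u = n - 2 \<or> t = n - 2 \<and> v = 2")
          case False
          then show ?thesis using split_gap[OF nz ends common nontriv(1-3), of s t u v] s u less.prems by auto
        next
          case True
          show ?thesis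
          proof (rule ccontr)
            assume o: "odd (v - u)"
            \<comment> \<open>Oddness of \<open>v - u\<close> settles the rest:
              \<open>u = n - 2\<close> forces \<open>v = n - 1\<close>, and \<open>v = 2\<close>
              forces \<open>u = 1\<close> and \<open>s = 1\<close>.\<close>
            have *: "s = 2 \<and> u = n - 2 \<and> v = n - 1 \<or> t = n - 2 \<and> v = 2 \<and> u = 1 \<and> s = 1"
            proof (cases "s = 2 \<and> u = n - 2")
              case True
              then show ?thesis using o u(3) less.prems(2,5) by presburger
            next
              case False
              then have t: "t = n - 2" "v = 2" using True by auto
              then have "u = 1" using o u s(2) by presburger
              then show ?thesis using t u(2) s(2) by auto
            qed
            show False
            proof (rule contra[of s t u])
              have "v = u + 1" using * by auto
              then show "A y (h i) \<longleftrightarrow> i = u \<or> i = u + 1" if "s \<le> i" "i \<le> t" for i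
              proof -
                consider "i < u" | "i = u" | "i = u + 1" | "v < i" using \<open>v = u + 1\<close> by linarith
                then show ?thesis
                  by cases (use that u(1) less.prems(6) u(4)[of i] less.prems(7)[of i] \<open>v = u + 1\<close> in auto)
              qed
            qed (use * s u less.prems n5 in auto)
          qed
        qed
        ultimately show ?thesis using odd' by presburger
      qed
    qed
  qed
  have "odd (n - 1)" using inv[of "n - 1" "n - 1"] ends n5 by auto
  then show False using odd by simp
qed

text \<open>The exceptional gap covers the path up to one end edge, so it determines both
  neighbourhoods. Which of \<open>y\<close> and \<open>z\<close> has which shape depends on the
  side, hence the unordered pair.\<close>

lemma two_nontrivial_shape:
  assumes nz: "\<not> A y z"
    and ends: "A z (h 1)" "A z (h (n - 1))" "A y (h 1)" "A y (h (n - 1))"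
    and common: "\<And>i. 2 \<le> i \<Longrightarrow> i \<le> n - 2 \<Longrightarrow> \<not> (A y (h i) \<and> A z (h i))"
    and nontriv: "2 \<le> k" "k \<le> n - 2" "A z (h k)" "2 \<le> k'" "k' \<le> n - 2" "A y (h k')"
  shows "\<exists>a b. {a, b} = {y, z} \<and> (\<forall>i\<in>{1..n - 1}. A a (h i) \<longleftrightarrow> i \<in> {1, 2, n - 1}) \<and>
    (\<forall>i\<in>{1..n - 1}. A b (h i) \<longleftrightarrow> i \<in> {1, n - 2, n - 1})"
proof -
  show ?thesis
  proof (rule two_nontrivial[OF assms])
    fix s u t assume st: "1 \<le> s" "s < t" "t \<le> n - 1" "A z (h s)" "A z (h t)"
      and z: "\<And>i. s < i \<Longrightarrow> i < t \<Longrightarrow> \<not> A z (h i)" and u: "s \<le> u" "u < t"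
      and y: "\<And>i. s \<le> i \<Longrightarrow> i \<le> t \<Longrightarrow> A y (h i) \<longleftrightarrow> i = u \<or> i = u + 1"
      and "s = 2 \<and> u = n - 2 \<or> t = n - 2 \<and> u = 1"
    from this(10) show ?thesis
    proof
      assume su: "s = 2 \<and> u = n - 2"
      then have t: "t = n - 1" using u st by linarith
      have "A z (h i) \<longleftrightarrow> i \<in> {1, 2, n - 1}" if "i \<in> {1..n - 1}" for i
        using that z[of i] su t st ends by (cases "i = 1 \<or> i = 2 \<or> i = n - 1") auto
      moreover have "A y (h i) \<longleftrightarrow> i \<in> {1, n - 2, n - 1}" if "i \<in> {1..n - 1}" for i
        using that y[of i] su t ends by (cases "i = 1") auto
      ultimately show ?thesis by blast
    next
      assume tu: "t = n - 2 \<and> u = 1"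
      then have s: "s = 1" using u st by linarith
      have "A z (h i) \<longleftrightarrow> i \<in> {1, n - 2, n - 1}" if "i \<in> {1..n - 1}" for i
        using that z[of i] tu s st ends by (cases "i = 1 \<or> i = n - 2 \<or> i = n - 1") auto
      moreover have "A y (h i) \<longleftrightarrow> i \<in> {1, 2, n - 1}" if "i \<in> {1..n - 1}" for i
        using that y[of i] tu s ends by (cases "i = n - 1") auto
      ultimately show ?thesis by blast
    qed
  qed
qed

end

section \<open>Contracted vertices and the shortest odd hole\<close>

text \<open>Finiteness makes contracted infinite sets isolated, so that cardinalities can be minimised.\<close>

fun contract_adj :: "('a \<Rightarrow> 'a \<Rightarrow> bool) \<Rightarrow> 'a + 'a set \<Rightarrow> 'a + 'a set \<Rightarrow> bool" where
  "contract_adj E (Inl u) (Inl v) = E u v"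
| "contract_adj E (Inl u) (Inr C) = (finite C \<and> (\<forall>x\<in>C. E u x))"
| "contract_adj E (Inr C) (Inl u) = (finite C \<and> (\<forall>x\<in>C. E u x))"
| "contract_adj E (Inr C) (Inr D) = False"

text \<open>Meaningful only for \<open>single\<close> vertices, where it gives the vertex of the
  Meyniel graph behind them.\<close>

fun rep :: "'a + 'a set \<Rightarrow> 'a" where
  "rep (Inl v) = v"
| "rep (Inr C) = the_elem C"

fun weight :: "'a + 'a set \<Rightarrow> nat" where
  "weight (Inl v) = 0"
| "weight (Inr C) = card C"

definition single :: "'a + 'a set \<Rightarrow> bool" where
  "single p \<longleftrightarrow> (\<forall>C. p = Inr C \<longrightarrow> (\<exists>x. C = {x}))"

text \<open>Indices are all integers, read modulo \<open>n\<close>, so that rotating and reflecting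
  the hole are a shift and a change of sign.\<close>

definition cyclic_hole :: "('v \<Rightarrow> 'v \<Rightarrow> bool) \<Rightarrow> int \<Rightarrow> (int \<Rightarrow> 'v) \<Rightarrow> bool" where
  "cyclic_hole A n h \<longleftrightarrow> (\<forall>i. h (i + n) = h i) \<and>
     (\<forall>i j. A (h i) (h j) \<longleftrightarrow> (j - i) mod n = 1 \<or> (i - j) mod n = 1)"

lemma cyclic_adjacent_iff:
  fixes i j n :: int
  assumes "3 \<le> n" "0 \<le> i" "i < j" "j < n"
  shows "(j - i) mod n = 1 \<or> (i - j) mod n = 1 \<longleftrightarrow> j = i + 1 \<or> i = 0 \<and> j = n - 1"
proof -
  have "(j - i) mod n = j - i" using assms by simp
  moreover have "(i - j) mod n = n - (j - i)"
    using assms mod_add_self2[of "i - j" n] mod_pos_pos_trivial[of "i - j + n" n] by auto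
  ultimately show ?thesis using assms by auto
qed

lemma cyclic_hole_mod:
  assumes "cyclic_hole A n h" shows "h (i mod n) = h i"
proof -
  have *: "h (i + n * int k) = h i" for i k
  proof (induction k)
    case (Suc k)
    have "i + n * int (Suc k) = (i + n * int k) + n" by (simp add: algebra_simps)
    then show ?case using Suc assms unfolding cyclic_hole_def by metis
  qed simp
  show ?thesis
  proof (cases "0 \<le> i div n")
    case True
    have "h i = h (i mod n + n * int (nat (i div n)))" using True by simp
    then show ?thesis using * by metis
  next
    case False
    have "i + n * int (nat (- (i div n))) = i mod n" using False by (simp add: minus_mult_div_eq_mod)
    then show ?thesis using * by metis
  qed
qed

context meyniel_rel
begin

abbreviation "A \<equiv> contract_adj E"

lemma A_sym: "A p q \<Longrightarrow> A q p"
  by (cases p; cases q) (auto intro: sym)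

lemma A_commute: "A p q \<longleftrightarrow> A q p"
  using A_sym by blast

lemma symp_A: "symp A" by (auto intro!: sympI A_sym)

lemma A_irrefl: "\<not> A p p"
  by (cases p) (auto simp: irrefl)

lemma A_isl: "A p q \<Longrightarrow> isl p \<or> isl q"
  by (cases p; cases q) auto

lemma A_antimono: "A (Inr C) q \<Longrightarrow> B \<subseteq> C \<Longrightarrow> A (Inr B) q"
  by (cases q) (auto intro: finite_subset)

lemma A_union: "A (Inr B) q \<Longrightarrow> A (Inr C) q \<Longrightarrow> A (Inr (B \<union> C)) q"
  by (cases q) auto

lemma A_Inl_rep: "single q \<Longrightarrow> A (Inl a) q \<longleftrightarrow> E a (rep q)"
  by (cases q) (auto simp: single_def)

text \<open>One side must be real: contracted singletons are nonadjacent whatever their elements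
  are. This is the only way in which \<open>rep\<close> may fail to preserve adjacency of single
  vertices.\<close>

lemma A_rep: "single p \<Longrightarrow> single q \<Longrightarrow> isl p \<or> isl q \<Longrightarrow> A p q \<longleftrightarrow> E (rep p) (rep q)"
  by (cases p; cases q) (auto simp: single_def intro: sym)

lemma A_Inr_single: "isl q \<Longrightarrow> A (Inr {x}) q \<longleftrightarrow> A (Inl x) q"
  by (cases q) (auto intro: sym)

lemma A_Inr_empty: "isl q \<Longrightarrow> A (Inr {}) q"
  by (cases q) auto

end

text \<open>\<open>pruned\<close> is what least weight amounts to: without a further neighbour,
  \<open>Inr B\<close> could replace \<open>h m\<close>. The residue 0 is \<open>h m\<close> itself;
  1 and \<open>n - 1\<close> are its neighbours on the hole, which \<open>Inr B\<close>
  inherits.\<close>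

locale min_hole = meyniel_rel E for E :: "'a \<Rightarrow> 'a \<Rightarrow> bool" +
  fixes n :: int and h :: "int \<Rightarrow> 'a + 'a set"
  assumes odd_n: "odd n" and n_ge_5: "5 \<le> n" and shortest: "odd_holes_ge A n"
    and hole: "cyclic_hole A n h"
    and pruned: "h m = Inr C \<Longrightarrow> B \<subset> C \<Longrightarrow> \<exists>i. (i - m) mod n \<notin> {0, 1, n - 1} \<and> A (Inr B) (h i)"
begin

lemma periodic: "h (i + n) = h i"
  using hole by (auto simp: cyclic_hole_def)

lemma h_mod: "h (i mod n) = h i"
  using cyclic_hole_mod[OF hole] .

lemma A_h: "A (h i) (h j) \<longleftrightarrow> (j - i) mod n = 1 \<or> (i - j) mod n = 1"
  using hole by (auto simp: cyclic_hole_def)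

lemma A_h_lt: "0 \<le> i \<Longrightarrow> i < j \<Longrightarrow> j < n \<Longrightarrow> A (h i) (h j) \<longleftrightarrow> j = i + 1 \<or> i = 0 \<and> j = n - 1"
  using A_h[of i j] cyclic_adjacent_iff[of n i j] n_ge_5 by simp

sublocale hole_path A h n
  by unfold_locales (use symp_A odd_n n_ge_5 shortest A_h_lt in auto)

lemma A_h0: "1 \<le> i \<Longrightarrow> i \<le> n - 1 \<Longrightarrow> A (h 0) (h i) \<longleftrightarrow> i = 1 \<or> i = n - 1"
  using A_h_lt[of 0 i] by auto

lemma rotate: "min_hole E n (\<lambda>i. h (i + m))"
proof
  show "cyclic_hole A n (\<lambda>i. h (i + m))"
    using periodic[of "_ + m"] A_h by (auto simp: cyclic_hole_def algebra_simps)
  fix k C B assume "h (k + m) = Inr C" "B \<subset> C"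
  then obtain i where "(i - (k + m)) mod n \<notin> {0, 1, n - 1}" "A (Inr B) (h i)" using pruned by blast
  then show "\<exists>i. (i - k) mod n \<notin> {0, 1, n - 1} \<and> A (Inr B) (h (i + m))"
    by (intro exI[of _ "i - m"]) (auto simp: algebra_simps)
qed (use odd_n n_ge_5 shortest in auto)

lemma reflect: "min_hole E n (\<lambda>i. h (- i))"
proof
  have "h (- i - n) = h (- i)" for i using periodic[of "- i - n"] by simp
  then show "cyclic_hole A n (\<lambda>i. h (- i))"
    using A_h by (auto simp: cyclic_hole_def)
  fix k C B assume "h (- k) = Inr C" "B \<subset> C"
  then obtain i where i: "(i + k) mod n \<notin> {0, 1, n - 1}" "A (Inr B) (h i)" using pruned[of "- k" C B] by auto
  have "- i - k = - (i + k)" by simp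
  then have "(- i - k) mod n = (if (i + k) mod n = 0 then 0 else n - (i + k) mod n)"
    using zmod_zminus1_eq_if by metis
  moreover have "(i + k) mod n < n" using n_ge_5 by simp
  ultimately have "(- i - k) mod n \<notin> {0, 1, n - 1}" using i(1) by (auto split: if_splits)
  then show "\<exists>i. (i - k) mod n \<notin> {0, 1, n - 1} \<and> A (Inr B) (h (- i))"
    using i(2) by (intro exI[of _ "- i"]) auto
qed (use odd_n n_ge_5 shortest in auto)

lemma ends_real:
  assumes "h 0 = Inr C" shows "isl (h 1)" "isl (h (n - 1))"
  using A_h0[of 1] A_h0[of "n - 1"] n_ge_5 assms A_isl[of "h 0" "h 1"] A_isl[of "h 0" "h (n - 1)"] by auto

text \<open>\<open>C\<close> is split into \<open>{x}\<close> and the rest. Each part has a further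
  neighbour by \<open>pruned\<close>, and no inner vertex sees both since their union is
  \<open>C\<close>, so only the exceptional shape remains. Which of its two parts is
  \<open>{x}\<close> stays open.\<close>

lemma single_or_skew:
  assumes h0: "h 0 = Inr C"
  obtains x where "C = {x}"
  | x B B' where "{x} = B \<or> {x} = B'"
      "\<And>i. i \<in> {1..n - 1} \<Longrightarrow> A (Inr B) (h i) \<longleftrightarrow> i \<in> {1, 2, n - 1}"
      "\<And>i. i \<in> {1..n - 1} \<Longrightarrow> A (Inr B') (h i) \<longleftrightarrow> i \<in> {1, n - 2, n - 1}"
proof -
  have "C \<noteq> {}"
  proof
    \<comment> \<open>The empty set sees every real vertex, and one of the consecutive
      \<open>h 2\<close> and \<open>h 3\<close> is real although \<open>h 0\<close> sees
      neither.\<close>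
    assume "C = {}"
    have "A (h 2) (h 3)" using path[of 2 3] n_ge_5 by auto
    then have "isl (h 2) \<or> isl (h 3)" by (rule A_isl)
    then show False using A_h0[of 2] A_h0[of 3] A_Inr_empty h0 \<open>C = {}\<close> n_ge_5 by auto
  qed
  then obtain x where x: "x \<in> C" by auto
  show ?thesis
  proof (cases "C = {x}")
    case True then show ?thesis using that(1) by blast
  next
    case False
    define D where "D = C - {x}"
    have psub: "{x} \<subset> C" "D \<subset> C" and C: "C = {x} \<union> D" using x False by (auto simp: D_def)
    have ends: "A (Inr B) (h 1)" "A (Inr B) (h (n - 1))" if "B \<subset> C" for B
      using that A_h0[of 1] A_h0[of "n - 1"] n_ge_5 h0 A_antimono[of C _ B] by auto
    have extra: "\<exists>k. 2 \<le> k \<and> k \<le> n - 2 \<and> A (Inr B) (h k)" if B: "B \<subset> C" for B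
    proof -
      obtain i where i: "i mod n \<notin> {0, 1, n - 1}" "A (Inr B) (h i)" using pruned[OF h0 B] by auto
      moreover have "0 \<le> i mod n" "i mod n < n" using n_ge_5 by auto
      ultimately have "2 \<le> i mod n" "i mod n \<le> n - 2" by auto
      then show ?thesis using i h_mod[of i] by (intro exI[of _ "i mod n"]) auto
    qed
    obtain k k' where k: "2 \<le> k" "k \<le> n - 2" "A (Inr {x}) (h k)" "2 \<le> k'" "k' \<le> n - 2" "A (Inr D) (h k')"
      using extra psub by metis
    have "\<not> (A (Inr D) (h i) \<and> A (Inr {x}) (h i))" if "2 \<le> i" "i \<le> n - 2" for i
      using A_union[of "{x}" "h i" D] A_h0[of i] h0 that C by auto
    then obtain a b where ab: "{a, b} = {Inr D, Inr {x}}"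
      "\<forall>i\<in>{1..n - 1}. A a (h i) \<longleftrightarrow> i \<in> {1, 2, n - 1}"
      "\<forall>i\<in>{1..n - 1}. A b (h i) \<longleftrightarrow> i \<in> {1, n - 2, n - 1}"
      using two_nontrivial_shape[of "Inr D" "Inr {x}", OF _ _ _ _ _ _ k] ends psub by auto
    then consider "a = Inr D" "b = Inr {x}" | "a = Inr {x}" "b = Inr D" by (auto simp: doubleton_eq_iff)
    then show ?thesis
    proof cases
      case 1 show ?thesis by (rule that(2)[of x D "{x}"]) (use ab(2,3) 1 in auto)
    next
      case 2 show ?thesis by (rule that(2)[of x "{x}" D]) (use ab(2,3) 2 in auto)
    qed
  qed
qed

text \<open>\<open>rep (h 1)\<close> is the roof over the edge from \<open>a\<close> to
  \<open>rep (h 2)\<close>; the walk follows the remaining hole from \<open>h 2\<close> to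
  \<open>h (n - 1)\<close> and ends in \<open>a\<close>. Edges between representatives of contracted
  vertices do no harm to a walk.\<close>

lemma triangle_at_h1:
  assumes singles: "\<And>i. 1 \<le> i \<Longrightarrow> i \<le> n - 1 \<Longrightarrow> single (h i)" and real1: "isl (h 1)"
    and a: "E a (rep (h 1))" "E a (rep (h 2))" "E a (rep (h (n - 1)))"
    and common: "\<And>l. 3 \<le> l \<Longrightarrow> l \<le> n - 1 \<Longrightarrow> \<not> (A (Inl a) (h l) \<and> E (rep (h 2)) (rep (h l)))"
  shows False
proof -
  define g where "g i = rep (h i)" for i
  have adj: "E (g i) (g j)" if "A (h i) (h j)" "1 \<le> i" "i \<le> n - 1" "1 \<le> j" "j \<le> n - 1" for i j
    using that A_rep[of "h i" "h j"] singles A_isl[OF that(1)] by (auto simp: g_def)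
  show False
  proof (rule roof[of a "g 2" "g 1" "map g [3..n - 1]"])
    show "E a (g 2)" "E (g 1) a" using a sym by (auto simp: g_def)
    show "E (g 1) (g 2)" using adj[of 1 2] path[of 1 2] n_ge_5 by auto
    show "map g [3..n - 1] \<noteq> []" using n_ge_5 by auto
    have "[2..n - 1] = 2 # [3..n - 1]" using upto_rec1[of 2 "n - 1"] n_ge_5 by auto
    moreover have "successively E (map g [2..n - 1])"
      unfolding successively_map successively_conv_nth
      using adj path by auto
    moreover have "last (map g [2..n - 1]) = g (n - 1)" using n_ge_5 by (simp add: upto_rec2)
    ultimately show "successively E (g 2 # map g [3..n - 1] @ [a])"
      using sym[OF a(3)] n_ge_5 by (auto simp: successively_append_iff successively_Cons g_def last_map)
    show "\<not> E (g 1) m" if "m \<in> set (map g [3..n - 1])" for m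
      using that A_rep[OF singles singles, of 1] real1 path[of 1] by (auto simp: g_def)
    show "\<not> (E a m \<and> E (g 2) m)" if "m \<in> set (map g [3..n - 1])" for m
      using that common A_Inl_rep[OF singles] by (auto simp: g_def)
  qed
qed

end

context min_hole
begin

text \<open>The real vertex \<open>x\<close> forms a triangle with \<open>h 1\<close> and
  \<open>h 2\<close>, to which \<open>triangle_at_h1\<close> applies once the other vertices are
  single and \<open>x\<close> misses \<open>h 3\<close>. The source of \<open>real'\<close> is the
  other part of \<open>C\<close>, which sees \<open>h (n - 2)\<close>.\<close>

lemma skew_impossible:
  assumes h0: "h 0 = Inr C"
    and x: "\<And>i. i \<in> {1..n - 1} \<Longrightarrow> A (Inr {x}) (h i) \<longleftrightarrow> i \<in> {1, 2, n - 1}"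
    and real': "isl (h (n - 2))"
  shows False
proof -
  have A_real: "A (Inl x) (h i) \<longleftrightarrow> i \<in> {1, 2, n - 1}" if "i \<in> {1..n - 1}" "isl (h i)" for i
    using x that A_Inr_single by metis
  have reals: "isl (h 1)" "isl (h 2)" "isl (h (n - 1))"
    using x[of 1] x[of 2] x[of "n - 1"] n_ge_5 A_isl[of "Inr {x}"] by auto
  have singles: "single (h m)" if m: "1 \<le> m" "m \<le> n - 1" for m
  proof (rule ccontr)
    assume ns: "\<not> single (h m)"
    then obtain D where D: "h m = Inr D" by (cases "h m") (auto simp: single_def)
    then have "m \<notin> {1, 2, n - 2, n - 1}" using reals real' by auto
    then have m3: "3 \<le> m" "m \<le> n - 3" using m by auto
    then have n7: "7 \<le> n" using odd_n by presburger
    interpret r: min_hole E n "\<lambda>i. h (i + m)" by (rule rotate)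
    have "h (0 + m) = Inr D" using D by simp
    then obtain B where B: "\<And>i. i \<in> {1..n - 1} \<Longrightarrow> A (Inr B) (h (i + m)) \<longleftrightarrow> i \<in> {1, 2, n - 1}"
    proof (rule r.single_or_skew)
      fix y assume "D = {y}"
      then show thesis using ns D by (auto simp: single_def)
    next
      fix B assume "\<And>i. i \<in> {1..n - 1} \<Longrightarrow> A (Inr B) (h (i + m)) \<longleftrightarrow> i \<in> {1, 2, n - 1}"
      then show thesis by (rule that)
    qed
    have B_gt: "A (Inr B) (h j) \<longleftrightarrow> j = m + 1 \<or> j = m + 2" if "m < j" "j \<le> n - 1" for j
      using B[of "j - m"] that m3 by auto
    have B_lt: "A (Inr B) (h j) \<longleftrightarrow> j = m - 1" if "1 \<le> j" "j < m" for j
      using B[of "j + n - m"] periodic[of j] that m3 by auto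
    \<comment> \<open>Two skew parts shortcut the hole twice, which restores the parity:
      \<open>Inr {x}\<close> replaces \<open>h 0\<close> and skips \<open>h 1\<close>,
      \<open>Inr B\<close> replaces \<open>h m\<close> and skips \<open>h (m + 1)\<close>. The odd
      hole has \<open>n - 2\<close> vertices.\<close>
    have "n \<le> (n - 2 - m) + (m - 2) + 2"
    proof (rule odd_hole_two_vertices[OF symp shortest, where z = "Inr B" and y = "Inr {x}"
          and p = "\<lambda>i. h (m + 2 + i)" and q = "\<lambda>i. h (m - 1 - i)"])
      show "ipath A (\<lambda>i. h (m + 2 + i)) (n - 2 - m)" using m3 by (intro segment) auto
      show "ipath A (\<lambda>i. h (m - 1 - i)) (m - 2)" using m3 by (intro segment_rev) auto
      show "A (Inr B) (h (m + 2 + i)) \<longleftrightarrow> i = 0" if "0 \<le> i" "i < n - 2 - m" for i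
        using B_gt[of "m + 2 + i"] that by auto
      show "A (Inr B) (h (m - 1 - i)) \<longleftrightarrow> i = 0" if "0 \<le> i" "i < m - 2" for i
        using B_lt[of "m - 1 - i"] that by auto
      show "A (Inr {x}) (h (m + 2 + i)) \<longleftrightarrow> i = n - 2 - m - 1" if "0 \<le> i" "i < n - 2 - m" for i
        using x[of "m + 2 + i"] that m3 by auto
      show "A (Inr {x}) (h (m - 1 - i)) \<longleftrightarrow> i = m - 2 - 1" if "0 \<le> i" "i < m - 2" for i
        using x[of "m - 1 - i"] that m3 by auto
      show "\<not> A (h (m + 2 + i)) (h (m - 1 - j))"
        if "0 \<le> i" "i < n - 2 - m" "0 \<le> j" "j < m - 2" for i j
        using path[of "m - 1 - j" "m + 2 + i"] A_commute that m3 by auto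
    qed (use m3 n7 odd_n in auto)
    then show False by simp
  qed
  \<comment> \<open>\<open>Inl x\<close> and \<open>Inr {x}\<close> differ only on contracted
    vertices. Of two adjacent neighbours of \<open>x\<close> from \<open>h 3\<close> on, one is real
    and thus \<open>h (n - 1)\<close>; the other would be \<open>h (n - 2)\<close>, which is real
    and missed by \<open>x\<close>. So the distance from 3 to \<open>n - 1\<close> would be even,
    but \<open>n\<close> is odd.\<close>
  have not3: "\<not> A (Inl x) (h 3)"
  proof
    assume a3: "A (Inl x) (h 3)"
    have con3: "\<not> isl (h 3)" using a3 A_real[of 3] n_ge_5 odd_n by auto
    define S where "S = {i \<in> {1..n - 1}. A (Inl x) (h i)}"
    have "even (n - 1 - 3)"
    proof (rule even_diff_if_no_adjacent[where S = S and p = 3 and q = "n - 1"])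
      show "t = s + 1" if "s \<in> S" "t \<in> S" "3 \<le> s" "t \<le> n - 1" "s < t"
        "\<And>i. s < i \<Longrightarrow> i < t \<Longrightarrow> i \<notin> S" "odd (t - s)" for s t
        by (rule gap[of s t "Inl x"]) (use that in \<open>auto simp: S_def\<close>)
      show False if s: "s \<in> S" "s + 1 \<in> S" "3 \<le> s" "s < n - 1" for s
      proof -
        have "\<not> isl (h s)" using A_real[of s] s by (auto simp: S_def)
        then have "isl (h (s + 1))" using A_isl[of "h s" "h (s + 1)"] path[of s "s + 1"] s by auto
        then have "s + 1 = n - 1" using A_real[of "s + 1"] s by (auto simp: S_def)
        then have "s = n - 2" by simp
        then show False using real' \<open>\<not> isl (h s)\<close> by simp
      qed
    qed (use a3 n_ge_5 A_real[of "n - 1"] reals in \<open>auto simp: S_def\<close>)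
    then show False using odd_n by simp
  qed
  show False
  proof (rule triangle_at_h1[of x])
    show "E x (rep (h 1))" "E x (rep (h 2))" "E x (rep (h (n - 1)))"
      using A_real[of 1] A_real[of 2] A_real[of "n - 1"] reals n_ge_5
        A_Inl_rep[of "h 1"] A_Inl_rep[of "h 2"] A_Inl_rep[of "h (n - 1)"] singles by auto
    show "\<not> (A (Inl x) (h l) \<and> E (rep (h 2)) (rep (h l)))" if "3 \<le> l" "l \<le> n - 1" for l
      using A_rep[of "h 2" "h l"] singles[of 2] singles[of l] reals path[of 2 l] that not3 by auto
  qed (use singles reals in auto)
qed

lemma all_single: "single (h m)"
  unfolding single_def
proof (intro allI impI)
  fix C assume C: "h m = Inr C"
  interpret r: min_hole E n "\<lambda>i. h (i + m)" by (rule rotate)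
  have r0: "h (0 + m) = Inr C" using C by simp
  show "\<exists>x. C = {x}"
  proof (rule r.single_or_skew[OF r0])
    fix x B B'
    assume xB: "{x} = B \<or> {x} = B'"
      and B: "\<And>i. i \<in> {1..n - 1} \<Longrightarrow> A (Inr B) (h (i + m)) \<longleftrightarrow> i \<in> {1, 2, n - 1}"
      and B': "\<And>i. i \<in> {1..n - 1} \<Longrightarrow> A (Inr B') (h (i + m)) \<longleftrightarrow> i \<in> {1, n - 2, n - 1}"
    have reals: "isl (h (2 + m))" "isl (h (n - 2 + m))"
      using B[of 2] B'[of "n - 2"] n_ge_5 A_isl[of "Inr B"] A_isl[of "Inr B'"] by auto
    from xB show ?thesis
    proof
      assume "{x} = B"
      then show ?thesis using r.skew_impossible[OF r0, of x] B reals by auto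
    next
      \<comment> \<open>Reflecting the hole about \<open>h m\<close> exchanges the two
        shapes.\<close>
      assume x: "{x} = B'"
      interpret s: min_hole E n "\<lambda>i. h (- i + m)" by (rule r.reflect)
      have eq: "h (- i + m) = h (n - i + m)" for i using periodic[of "- i + m"] by (simp add: algebra_simps)
      have False
      proof (rule s.skew_impossible[of C x])
        show "A (Inr {x}) (h (- i + m)) \<longleftrightarrow> i \<in> {1, 2, n - 1}" if "i \<in> {1..n - 1}" for i
          using B'[of "n - i"] that eq[of i] x by auto
        show "isl (h (- (n - 2) + m))" using eq[of "n - 2"] reals by simp
      qed (use C in simp)
      then show ?thesis ..
    qed
  qed blast
qed

context
  fixes x assumes h0: "h 0 = Inr {x}"
begin

lemma A_Inl_real: "i \<in> {1..n - 1} \<Longrightarrow> isl (h i) \<Longrightarrow> A (Inl x) (h i) \<longleftrightarrow> i \<in> {1, n - 1}"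
  using A_h0[of i] h0 A_Inr_single by auto

text \<open>Consecutive neighbours of \<open>x\<close> at odd distance are adjacent on the hole; one
  of them is then real, so the pair is at 1, 2 or at \<open>n - 2\<close>, \<open>n - 1\<close>.
  Since 1 and \<open>n - 1\<close> have odd difference, one of these pairs occurs; since 2 and
  \<open>n - 2\<close> do as well, not both. All other distances are even.\<close>

lemma A_Inl_parity:
  assumes k: "2 \<le> k" "k \<le> n - 2" "A (Inl x) (h k)"
  shows "A (Inl x) (h 2) \<or> A (Inl x) (h (n - 2))"
    and "A (Inl x) (h 2) \<Longrightarrow> A (Inl x) (h i) \<Longrightarrow> 2 \<le> i \<Longrightarrow> i \<le> n - 1 \<Longrightarrow> even i"
    and "A (Inl x) (h (n - 2)) \<Longrightarrow> A (Inl x) (h i) \<Longrightarrow> 1 \<le> i \<Longrightarrow> i \<le> n - 2 \<Longrightarrow> odd i"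
proof -
  define S where "S = {i \<in> {1..n - 1}. A (Inl x) (h i)}"
  have S1: "1 \<in> S" "n - 1 \<in> S" "k \<in> S"
    using A_Inl_real[of 1] A_Inl_real[of "n - 1"] ends_real[OF h0] n_ge_5 k by (auto simp: S_def)
  have gapS: "t = s + 1" if "s \<in> S" "t \<in> S" "s < t"
    "\<And>i. s < i \<Longrightarrow> i < t \<Longrightarrow> i \<notin> S" "odd (t - s)" for s t
  proof (rule gap[of s t "Inl x"])
    show "\<not> (s = 1 \<and> t = n - 1)" using that(4)[of k] S1 k by auto
  qed (use that in \<open>auto simp: S_def\<close>)
  have adjS: "s = 1 \<or> s = n - 2" if s: "s \<in> S" "s + 1 \<in> S" for s
  proof -
    have "isl (h s) \<or> isl (h (s + 1))" using A_isl[of "h s" "h (s + 1)"] path[of s "s + 1"] s by (auto simp: S_def)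
    then show ?thesis using A_Inl_real[of s] A_Inl_real[of "s + 1"] s by (auto simp: S_def)
  qed
  have even_diff: "even (t - s)" if "s \<in> S" "t \<in> S" "p \<le> s" "s \<le> t" "t \<le> q"
    "p \<le> 1 \<longrightarrow> 2 \<notin> S" "n - 1 \<le> q \<longrightarrow> n - 2 \<notin> S" for s t p q
  proof (rule even_diff_if_no_adjacent[of S p q, OF gapS _ that(1-3,5,4)])
    show False if "r \<in> S" "r + 1 \<in> S" "p \<le> r" "r < q" for r
      using adjS[OF that(1,2)] that \<open>p \<le> 1 \<longrightarrow> 2 \<notin> S\<close> \<open>n - 1 \<le> q \<longrightarrow> n - 2 \<notin> S\<close> by auto
  qed
  have not_both: "\<not> (2 \<in> S \<and> n - 2 \<in> S)" using even_diff[of 2 "n - 2" 2 "n - 2"] odd_n n_ge_5 by auto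
  have "2 \<in> S \<or> n - 2 \<in> S" using even_diff[of 1 "n - 1" 1 "n - 1"] odd_n n_ge_5 S1 by auto
  then show "A (Inl x) (h 2) \<or> A (Inl x) (h (n - 2))" by (auto simp: S_def)
  show "even i" if "A (Inl x) (h 2)" "A (Inl x) (h i)" "2 \<le> i" "i \<le> n - 1"
  proof -
    have "2 \<in> S" "i \<in> S" using that n_ge_5 by (auto simp: S_def)
    then have "even (i - 2)" using even_diff[of 2 i 2 "n - 1"] not_both that by auto
    then show ?thesis by simp
  qed
  show "odd i" if "A (Inl x) (h (n - 2))" "A (Inl x) (h i)" "1 \<le> i" "i \<le> n - 2"
  proof -
    have "n - 2 \<in> S" "i \<in> S" using that n_ge_5 by (auto simp: S_def)
    then have "even (n - 2 - i)" using even_diff[of i "n - 2" 1 "n - 2"] not_both that by auto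
    then show ?thesis using odd_n by simp
  qed
qed

text \<open>If \<open>x\<close> sees \<open>h 2 = Inr {y}\<close>, the triangle on \<open>x\<close>,
  \<open>h 1\<close> and \<open>y\<close> meets \<open>triangle_at_h1\<close>. A common neighbour
  \<open>h l\<close> of \<open>x\<close> and \<open>y\<close> is impossible by parity: seen from
  \<open>h 0\<close>, \<open>l\<close> is even; seen from \<open>h 2\<close>, where
  \<open>h 0\<close> has index \<open>n - 2\<close>, \<open>l - 2\<close> is odd.\<close>

lemma no_short_chord: "\<not> A (Inl x) (h 2)"
proof
  assume x2: "A (Inl x) (h 2)"
  have "\<not> isl (h 2)" using A_Inl_real[of 2] x2 n_ge_5 by auto
  then obtain y where y: "h 2 = Inr {y}" using all_single[of 2] by (cases "h 2") (auto simp: single_def)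
  interpret r: min_hole E n "\<lambda>i. h (i + 2)" by (rule rotate)
  have r0: "h (0 + 2) = Inr {y}" using y by simp
  have xy: "E x y" using x2 y by simp
  have yx: "A (Inl y) (h (n - 2 + 2))" using periodic[of 0] h0 sym[OF xy] by simp
  show False
  proof (rule triangle_at_h1[of x])
    show "E x (rep (h 1))" "E x (rep (h 2))" "E x (rep (h (n - 1)))"
      using A_Inl_real[of 1] A_Inl_real[of "n - 1"] ends_real[OF h0] n_ge_5
        A_Inl_rep[OF all_single] x2 by auto
    show "\<not> (A (Inl x) (h l) \<and> E (rep (h 2)) (rep (h l)))" if l: "3 \<le> l" "l \<le> n - 1" for l
    proof
      assume *: "A (Inl x) (h l) \<and> E (rep (h 2)) (rep (h l))"
      then have "A (Inl y) (h (l - 2 + 2))" using A_Inl_rep[OF all_single, of y l] y by simp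
      then have "odd (l - 2)"
        using r.A_Inl_parity(3)[OF r0, of "n - 2" "l - 2"] yx l n_ge_5 by auto
      moreover have "even l" using A_Inl_parity(2)[of 2 l] x2 * l n_ge_5 by auto
      ultimately show False by simp
    qed
  qed (use all_single ends_real[OF h0] in auto)
qed

end

lemma contradiction: False
proof -
  have no_chord: "\<not> E x y" if m: "h m = Inr {x}" and k: "h k = Inr {y}" for m k x y
  proof
    assume xy: "E x y"
    interpret r: min_hole E n "\<lambda>i. h (i + m)" by (rule rotate)
    have r0: "h (0 + m) = Inr {x}" using m by simp
    define l where "l = (k - m) mod n"
    have hl: "h (l + m) = Inr {y}" using h_mod[of k] h_mod[of "l + m"] k by (simp add: l_def mod_simps)
    have "0 \<le> l" "l < n" using n_ge_5 by (auto simp: l_def)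
    moreover have "l \<noteq> 0" using hl r0 xy irrefl by auto
    moreover have "l \<noteq> 1" "l \<noteq> n - 1" using r.ends_real[OF r0] hl by auto
    ultimately have l: "2 \<le> l" "l \<le> n - 2" by auto
    have "\<not> A (Inl x) (h (2 + m))" using r.no_short_chord[OF r0] .
    moreover have "A (Inl x) (h (l + m))" using hl xy by simp
    ultimately have x2: "A (Inl x) (h (n - 2 + m))" using r.A_Inl_parity(1)[OF r0 l] by auto
    interpret s: min_hole E n "\<lambda>i. h (- i + m)" by (rule r.reflect)
    have "h (- 2 + m) = h (n - 2 + m)" using periodic[of "- 2 + m"] by (simp add: algebra_simps)
    then show False using s.no_short_chord[of x] x2 r0 by simp
  qed
  define g where "g i = rep (h i)" for i
  have E_g: "E (g i) (g j) \<longleftrightarrow> A (h i) (h j)" for i j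
  proof (cases "isl (h i) \<or> isl (h j)")
    case True then show ?thesis using A_rep[OF all_single all_single] by (simp add: g_def)
  next
    case False
    then obtain x y where "h i = Inr {x}" "h j = Inr {y}"
      using all_single[of i] all_single[of j] by (cases "h i"; cases "h j") (auto simp: single_def)
    then show ?thesis using no_chord by (simp add: g_def)
  qed
  \<comment> \<open>Equal representatives would have the same neighbours on the hole, but a cycle on
    at least five vertices has no two such vertices.\<close>
  have inj: "g i \<noteq> g j" if "0 \<le> i" "i < j" "j < n" for i j
  proof
    assume "g i = g j"
    then have eq: "A (h i) (h k) \<longleftrightarrow> A (h j) (h k)" for k using E_g by metis
    show False
    proof (cases "i = 0")
      case True
      have "A (h j) (h 1)" using eq[of 1] A_h_lt[of 0 1] True n_ge_5 by auto
      then have "j = 2" using A_h_lt[of 1 j] A_commute[of "h j"] A_irrefl that True by (cases "j = 1") auto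
      then show False using eq[of "n - 1"] A_h_lt[of 0 "n - 1"] A_h_lt[of 2 "n - 1"] True n_ge_5 by auto
    next
      case False
      have "A (h i) (h (i - 1))" using A_h_lt[of "i - 1" i] A_commute that False by auto
      then have "i = 1" "j = n - 1" using eq[of "i - 1"] A_h_lt[of "i - 1" j] A_commute that False by auto
      then show False using eq[of 2] A_h_lt[of 1 2] A_h_lt[of 2 "n - 1"] A_commute[of "h (n - 1)"] n_ge_5 by auto
    qed
  qed
  define p where "p = map (\<lambda>i. g (int i)) [0..<nat n]"
  have len: "length p = nat n" and nth: "\<And>i. i < nat n \<Longrightarrow> p ! i = g (int i)" by (auto simp: p_def)
  show False
  proof (rule two_chords[of p])
    show "distinct p" unfolding distinct_conv_nth len
      using inj nth by (metis linorder_neqE_nat of_nat_0_le_iff of_nat_less_iff zless_nat_eq_int_zless)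
    show "odd (length p)" using odd_n n_ge_5 by (simp add: len even_nat_iff)
    show "5 \<le> length p" using n_ge_5 by (simp add: len)
    show "E (p ! i) (p ! Suc i)" if "Suc i < length p" for i
      using that nth[of i] nth[of "Suc i"] E_g A_h_lt[of "int i" "int (Suc i)"] by (auto simp: len)
    show "E (p ! (length p - 1)) (p ! 0)"
      using nth[of 0] nth[of "nat n - 1"] E_g A_h_lt[of 0 "n - 1"] A_commute n_ge_5 by (auto simp: len of_nat_diff)
    show "j = Suc i \<or> i = 0 \<and> (j = length p - 1 \<or> j = length p - 2)"
      if "i < j" "j < length p" "E (p ! i) (p ! j)" for i j
      using that nth[of i] nth[of j] E_g A_h_lt[of "int i" "int j"] by (auto simp: len)
  qed
qed

end

section \<open>Odd holes are excluded\<close>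

lemma cyclic_holeI:
  assumes n: "3 \<le> n" and sym: "symp A" and irr: "\<And>v. \<not> A v v"
    and g: "\<And>a b. 0 \<le> a \<Longrightarrow> a < b \<Longrightarrow> b < n \<Longrightarrow> A (g a) (g b) \<longleftrightarrow> b = a + 1 \<or> a = 0 \<and> b = n - 1"
  shows "cyclic_hole A n (\<lambda>i. g (i mod n))"
  unfolding cyclic_hole_def
proof (intro conjI allI)
  have lt: "A (g a) (g b) \<longleftrightarrow> (b - a) mod n = 1 \<or> (a - b) mod n = 1" if "0 \<le> a" "a < b" "b < n" for a b
    using g[OF that] cyclic_adjacent_iff[OF n that] by simp
  fix i j
  define a b where "a = i mod n" and "b = j mod n"
  have ab: "0 \<le> a" "a < n" "0 \<le> b" "b < n" using n by (auto simp: a_def b_def)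
  have "A (g a) (g b) \<longleftrightarrow> (b - a) mod n = 1 \<or> (a - b) mod n = 1"
    using lt[of a b] lt[of b a] irr ab sym by (cases a b rule: linorder_cases) (auto dest: sympD)
  then show "A (g (i mod n)) (g (j mod n)) \<longleftrightarrow> (j - i) mod n = 1 \<or> (i - j) mod n = 1"
    by (simp add: a_def b_def mod_diff_eq)
qed simp

lemma cyclic_hole_replace:
  assumes n: "3 \<le> n" and sym: "symp A" and irr: "\<And>v. \<not> A v v" and h: "cyclic_hole A n h"
    and z: "\<And>i. (i - m) mod n \<noteq> 0 \<Longrightarrow> A z (h i) \<longleftrightarrow> (i - m) mod n = 1 \<or> (i - m) mod n = n - 1"
  shows "cyclic_hole A n (\<lambda>i. if (i - m) mod n = 0 then z else h i)"
  unfolding cyclic_hole_def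
proof (intro conjI allI)
  fix i j
  have minus: "(- k) mod n = 1 \<longleftrightarrow> k mod n = n - 1" for k :: int
    using zmod_zminus1_eq_if[of k n] n by auto
  have zj: "A z (h j) \<longleftrightarrow> (j - i) mod n = 1 \<or> (i - j) mod n = 1"
    if "(i - m) mod n = 0" "(j - m) mod n \<noteq> 0" for i j
  proof -
    have "(j - i) mod n = (j - m - (i - m)) mod n" by simp
    also have "\<dots> = (j - m) mod n" using that(1) by (metis diff_zero mod_diff_right_eq)
    finally have "(j - i) mod n = (j - m) mod n" .
    then show ?thesis using z[OF that(2)] minus[of "j - i"] by simp
  qed
  have "(j - i) mod n = 0" "(i - j) mod n = 0" if "(i - m) mod n = 0" "(j - m) mod n = 0"
    using that mod_diff_eq[of "j - m" n "i - m"] mod_diff_eq[of "i - m" n "j - m"] by auto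
  then show "A (if (i - m) mod n = 0 then z else h i) (if (j - m) mod n = 0 then z else h j) \<longleftrightarrow>
    (j - i) mod n = 1 \<or> (i - j) mod n = 1"
    using zj[of i j] zj[of j i] irr h sym by (auto simp: cyclic_hole_def dest: sympD)
next
  fix i
  have "(i + n - m) mod n = (i - m) mod n"
    using mod_add_self2[of "i - m" n] by (simp add: algebra_simps)
  then show "(if (i + n - m) mod n = 0 then z else h (i + n)) = (if (i - m) mod n = 0 then z else h i)"
    using h by (auto simp: cyclic_hole_def)
qed

context meyniel_rel
begin

lemma no_odd_hole: "\<not> odd_hole A z f l"
proof
  assume "odd_hole A z f l"
  define P where "P k \<longleftrightarrow> (\<exists>z f. odd_hole A z f (int k))" for k
  have P: "P (nat l)" if "odd_hole A z f l" for z f l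
    using that by (auto simp: P_def odd_hole_def)
  define k where "k = (LEAST k. P k)"
  have "P k" unfolding k_def by (rule LeastI, rule P) fact
  then obtain z f where zf: "odd_hole A z f (int k)" by (auto simp: P_def)
  define n where "n = int k + 1"
  have shortest: "odd_holes_ge A n"
    unfolding odd_holes_ge_def
  proof (intro allI impI)
    fix z f l assume o: "odd_hole A z f l"
    then have "k \<le> nat l" unfolding k_def by (intro Least_le P)
    then show "n \<le> l + 1" using o by (auto simp: n_def odd_hole_def)
  qed
  have n: "odd n" "5 \<le> n" using zf by (auto simp: n_def odd_hole_def)
  define h0 where "h0 i = (if i = 0 then z else f (i - 1))" for i
  have "cyclic_hole A n (\<lambda>i. h0 (i mod n))"
  proof (rule cyclic_holeI[OF _ symp_A A_irrefl])
    fix a b assume ab: "0 \<le> a" "a < b" "b < n"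
    show "A (h0 a) (h0 b) \<longleftrightarrow> b = a + 1 \<or> a = 0 \<and> b = n - 1"
      using zf ab unfolding odd_hole_def ipath_def h0_def n_def by auto
  qed (use n in simp)
  \<comment> \<open>Length is minimised first; the total weight is then compared only among holes
    with the same \<open>n\<close>.\<close>
  define wt where "wt h = (\<Sum>i\<in>{0..<n}. weight (h i))" for h :: "int \<Rightarrow> 'a + 'a set"
  define h where "h = (ARG_MIN wt h. cyclic_hole A n h)"
  have hole: "cyclic_hole A n h" and min: "\<And>h'. cyclic_hole A n h' \<Longrightarrow> wt h \<le> wt h'"
    using arg_min_nat_lemma[of "cyclic_hole A n" _ wt, OF \<open>cyclic_hole A n (\<lambda>i. h0 (i mod n))\<close>]
    by (auto simp: h_def)
  have "min_hole E n h"
  proof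
    fix m C B assume C: "h m = Inr C" and B: "B \<subset> C"
    show "\<exists>i. (i - m) mod n \<notin> {0, 1, n - 1} \<and> A (Inr B) (h i)"
    proof (rule ccontr)
      assume none: "\<not> ?thesis"
      define h' where "h' i = (if (i - m) mod n = 0 then Inr B else h i)" for i
      have m1: "A (Inr C) (h i)" if "(i - m) mod n = 1 \<or> (i - m) mod n = n - 1" for i
      proof -
        have "(m - i) mod n = 1" if "(i - m) mod n = n - 1"
          using zmod_zminus1_eq_if[of "i - m" n] that n by auto
        then have "A (h m) (h i)" using hole that unfolding cyclic_hole_def by auto
        then show ?thesis using C by simp
      qed
      have "cyclic_hole A n h'"
        unfolding h'_def
      proof (rule cyclic_hole_replace[OF _ symp_A A_irrefl hole])
        show "A (Inr B) (h i) \<longleftrightarrow> (i - m) mod n = 1 \<or> (i - m) mod n = n - 1" if "(i - m) mod n \<noteq> 0" for i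
          using none that m1[of i] A_antimono[of C "h i" B] B by auto
      qed (use n in simp)
      then have "wt h \<le> wt h'" by (rule min)
      moreover have "wt h' < wt h"
        unfolding wt_def
      proof (rule sum_strict_mono_ex1)
        have hper: "h i = h m" if "(i - m) mod n = 0" for i
          using that cyclic_hole_mod[OF hole] by (metis mod_eq_dvd_iff mod_eq_0_iff_dvd)
        \<comment> \<open>Infinite sets are isolated, whereas \<open>h m\<close> has a neighbour.
          Without finiteness a proper subset need not have smaller cardinality.\<close>
        have "finite C" using m1[of "m + 1"] n by (cases "h (m + 1)") auto
        then have "card B < card C" using B by (rule psubset_card_mono)
        then show "\<forall>i\<in>{0..<n}. weight (h' i) \<le> weight (h i)"
          using hper C by (auto simp: h'_def)
        show "\<exists>i\<in>{0..<n}. weight (h' i) < weight (h i)"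
        proof
          show "m mod n \<in> {0..<n}" using n by auto
          have "(m mod n - m) mod n = 0" by (simp add: mod_simps)
          then show "weight (h' (m mod n)) < weight (h (m mod n))"
            using hper[of "m mod n"] C \<open>card B < card C\<close> by (simp add: h'_def)
        qed
      qed simp
      ultimately show False by simp
    qed
  qed (use n shortest hole in auto)
  then show False by (rule min_hole.contradiction)
qed

lemma no_odd_holes: "odd_holes_ge A n"
  using no_odd_hole by (auto simp: odd_holes_ge_def)

end

definition prism :: "('v \<Rightarrow> 'v \<Rightarrow> bool) \<Rightarrow> (int \<Rightarrow> 'v) \<Rightarrow> int \<Rightarrow> (int \<Rightarrow> 'v) \<Rightarrow> int \<Rightarrow> (int \<Rightarrow> 'v) \<Rightarrow> int \<Rightarrow> bool" where
  "prism A u r v s w t \<longleftrightarrow> 1 \<le> r \<and> 1 \<le> s \<and> 1 \<le> t \<and>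
     ipath A u (r + 1) \<and> ipath A v (s + 1) \<and> ipath A w (t + 1) \<and>
     (\<forall>i\<in>{0..r}. \<forall>j\<in>{0..s}. A (u i) (v j) \<longleftrightarrow> i = 0 \<and> j = 0 \<or> i = r \<and> j = s) \<and>
     (\<forall>i\<in>{0..s}. \<forall>j\<in>{0..t}. A (v i) (w j) \<longleftrightarrow> i = 0 \<and> j = 0 \<or> i = s \<and> j = t) \<and>
     (\<forall>i\<in>{0..r}. \<forall>j\<in>{0..t}. A (u i) (w j) \<longleftrightarrow> i = 0 \<and> j = 0 \<or> i = r \<and> j = t)"

lemma prism_rotate:
  assumes "symp A" "prism A u r v s w t" shows "prism A v s w t u r"
proof -
  have "A x y \<longleftrightarrow> A y x" for x y using assms(1) by (auto dest: sympD)
  then show ?thesis using assms(2) unfolding prism_def by auto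
qed

lemma prism_swap:
  assumes "symp A" "prism A u r v s w t" shows "prism A u r w t v s"
proof -
  have "A x y \<longleftrightarrow> A y x" for x y using assms(1) by (auto dest: sympD)
  then show ?thesis using assms(2) unfolding prism_def by auto
qed

lemma ipath_rev: "symp A \<Longrightarrow> ipath A u (r + 1) \<Longrightarrow> ipath A (\<lambda>i. u (r - i)) (r + 1)"
  unfolding ipath_def
proof (intro allI impI)
  fix i j assume "symp A" and u: "\<forall>i j. 0 \<le> i \<and> i < j \<and> j < r + 1 \<longrightarrow> A (u i) (u j) = (j = i + 1)"
    and ij: "0 \<le> i \<and> i < j \<and> j < r + 1"
  then have "A (u (r - j)) (u (r - i)) \<longleftrightarrow> j = i + 1"
    using u[rule_format, of "r - j" "r - i"] by auto
  then show "A (u (r - i)) (u (r - j)) = (j = i + 1)"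
    using \<open>symp A\<close> by (metis sympD)
qed

lemma prism_reverse:
  assumes "symp A" "prism A u r v s w t"
  shows "prism A (\<lambda>i. u (r - i)) r (\<lambda>i. v (s - i)) s (\<lambda>i. w (t - i)) t"
  using assms(2) ipath_rev[OF assms(1)] unfolding prism_def by auto

section \<open>Prisms\<close>

text \<open>Two of \<open>a\<close>, \<open>b\<close>, \<open>c\<close> have the same parity, and
  the cycle through \<open>z\<close> and the two corresponding paths is then odd. The bounds on the
  sums, which exclude that \<open>z\<close> sees two vertices of the triangle, make its length at
  least 5.\<close>

lemma pyramid:
  assumes sym: "symp A" and noh: "\<And>n. odd_holes_ge A n"
    and p: "ipath A p a" and q: "ipath A q b" and r: "ipath A r c"
    and abc: "1 \<le> a" "1 \<le> b" "1 \<le> c" "3 \<le> a + b" "3 \<le> a + c" "3 \<le> b + c"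
    and zp: "\<And>i. 0 \<le> i \<Longrightarrow> i < a \<Longrightarrow> A z (p i) \<longleftrightarrow> i = 0"
    and zq: "\<And>i. 0 \<le> i \<Longrightarrow> i < b \<Longrightarrow> A z (q i) \<longleftrightarrow> i = 0"
    and zr: "\<And>i. 0 \<le> i \<Longrightarrow> i < c \<Longrightarrow> A z (r i) \<longleftrightarrow> i = 0"
    and pq: "\<And>i j. 0 \<le> i \<Longrightarrow> i < a \<Longrightarrow> 0 \<le> j \<Longrightarrow> j < b \<Longrightarrow> A (p i) (q j) \<longleftrightarrow> i = a - 1 \<and> j = b - 1"
    and pr: "\<And>i j. 0 \<le> i \<Longrightarrow> i < a \<Longrightarrow> 0 \<le> j \<Longrightarrow> j < c \<Longrightarrow> A (p i) (r j) \<longleftrightarrow> i = a - 1 \<and> j = c - 1"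
    and qr: "\<And>i j. 0 \<le> i \<Longrightarrow> i < b \<Longrightarrow> 0 \<le> j \<Longrightarrow> j < c \<Longrightarrow> A (q i) (r j) \<longleftrightarrow> i = b - 1 \<and> j = c - 1"
  shows False
proof -
  have "\<not> (even (a + b) \<and> 4 \<le> a + b)"
    using odd_hole_two_paths[OF sym noh p q abc(1,2) _ _ zp zq pq, of "a + b + 2"] by auto
  moreover have "\<not> (even (a + c) \<and> 4 \<le> a + c)"
    using odd_hole_two_paths[OF sym noh p r abc(1,3) _ _ zp zr pr, of "a + c + 2"] by auto
  moreover have "\<not> (even (b + c) \<and> 4 \<le> b + c)"
    using odd_hole_two_paths[OF sym noh q r abc(2,3) _ _ zq zr qr, of "b + c + 2"] by auto
  ultimately show False using abc by presburger
qed

lemma ipath_seg: "ipath A f m \<Longrightarrow> 0 \<le> k \<Longrightarrow> k + l \<le> m \<Longrightarrow> ipath A (\<lambda>i. f (k + i)) l"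
  unfolding ipath_def by auto

lemma prismD:
  assumes "prism A u r v s w t"
  shows "1 \<le> r" "1 \<le> s" "1 \<le> t" "ipath A u (r + 1)" "ipath A v (s + 1)" "ipath A w (t + 1)"
    and "0 \<le> i \<Longrightarrow> i \<le> r \<Longrightarrow> 0 \<le> j \<Longrightarrow> j \<le> s \<Longrightarrow> A (u i) (v j) \<longleftrightarrow> i = 0 \<and> j = 0 \<or> i = r \<and> j = s"
    and "0 \<le> i \<Longrightarrow> i \<le> s \<Longrightarrow> 0 \<le> j \<Longrightarrow> j \<le> t \<Longrightarrow> A (v i) (w j) \<longleftrightarrow> i = 0 \<and> j = 0 \<or> i = s \<and> j = t"
    and "0 \<le> i \<Longrightarrow> i \<le> r \<Longrightarrow> 0 \<le> j \<Longrightarrow> j \<le> t \<Longrightarrow> A (u i) (w j) \<longleftrightarrow> i = 0 \<and> j = 0 \<or> i = r \<and> j = t"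
    and "0 \<le> i \<Longrightarrow> i < j \<Longrightarrow> j \<le> r \<Longrightarrow> A (u i) (u j) \<longleftrightarrow> j = i + 1"
    and "0 \<le> i \<Longrightarrow> i < j \<Longrightarrow> j \<le> s \<Longrightarrow> A (v i) (v j) \<longleftrightarrow> j = i + 1"
    and "0 \<le> i \<Longrightarrow> i < j \<Longrightarrow> j \<le> t \<Longrightarrow> A (w i) (w j) \<longleftrightarrow> j = i + 1"
  using assms unfolding prism_def ipath_def by auto

text \<open>The paths \<open>u\<close> and \<open>v\<close> close to a chordless cycle on
  \<open>r + s + 2\<close> vertices. As \<open>noh\<close> holds for every bound, it is instantiated
  with one more than that; the same device recurs below.\<close>

lemma prism_parity:
  assumes sym: "symp A" and noh: "\<And>n. odd_holes_ge A n" and pr: "prism A u r v s w t"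
  shows "even (r + s)"
proof (rule ccontr)
  assume o: "odd (r + s)"
  note P = prismD[OF pr]
  have "r + s + 3 \<le> r + (s + 1) + 1"
  proof (rule odd_hole_two_paths[OF sym noh, where z = "u 0" and p = "\<lambda>i. u (1 + i)" and q = v])
    show "ipath A (\<lambda>i. u (1 + i)) r" by (rule ipath_seg[OF P(4)]) auto
    show "4 \<le> r + (s + 1)" using o P(1,2) by presburger
    show "A (u 0) (u (1 + i)) \<longleftrightarrow> i = 0" if "0 \<le> i" "i < r" for i
      using P(10)[of 0 "1 + i"] that by auto
    show "A (u 0) (v i) \<longleftrightarrow> i = 0" if "0 \<le> i" "i < s + 1" for i
      using P(7)[of 0 i] P(1) that by auto
    show "A (u (1 + i)) (v j) \<longleftrightarrow> i = r - 1 \<and> j = s + 1 - 1" if "0 \<le> i" "i < r" "0 \<le> j" "j < s + 1" for i j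
      using P(7)[of "1 + i" j] that by auto
  qed (use P o in auto)
  then show False by simp
qed

context
  fixes A :: "'v \<Rightarrow> 'v \<Rightarrow> bool" and u v w :: "int \<Rightarrow> 'v" and r s t i :: int and z :: 'v
  assumes sym: "symp A" and noh: "\<And>n. odd_holes_ge A n" and pr: "prism A u r v s w t"
    and smallest: "\<And>u' r' v' s' w' t'. prism A u' r' v' s' w' t' \<Longrightarrow> r + s + t \<le> r' + s' + t'"
    and i: "0 \<le> i" "i < r" and z_next: "A z (u (i + 1))"
begin

private lemma A_com: "A x y \<longleftrightarrow> A y x" using sym by (auto dest: sympD)

text \<open>The parts of the three paths after the last neighbours of \<open>z\<close> form a
  pyramid, unless \<open>z\<close> sees two vertices of the triangle at the far end or the edge from
  \<open>v 0\<close> to \<open>w 0\<close> intervenes. In the latter case \<open>z\<close> followed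
  by \<open>u p\<close>, ..., \<open>u r\<close> replaces the path \<open>u\<close>, and
  \<open>nontriv\<close> makes this prism smaller.\<close>

lemma attach_both:
  assumes j: "0 \<le> j" "j \<le> s" "A z (v j)" "\<And>k. j < k \<Longrightarrow> k \<le> s \<Longrightarrow> \<not> A z (v k)"
    and l: "0 \<le> l" "l \<le> t" "A z (w l)" "\<And>k. l < k \<Longrightarrow> k \<le> t \<Longrightarrow> \<not> A z (w k)"
    and nontriv: "j = 0 \<Longrightarrow> l = 0 \<Longrightarrow> \<exists>k. 2 \<le> k \<and> k \<le> r \<and> i < k \<and> A z (u k)"
  shows "A z (u r) \<and> A z (v s) \<or> A z (u r) \<and> A z (w t) \<or> A z (v s) \<and> A z (w t)"
proof -
  note P = prismD[OF pr]
  obtain p where p: "A z (u p)" "i + 1 \<le> p" "p \<le> r" "\<And>k. p < k \<Longrightarrow> k \<le> r \<Longrightarrow> \<not> A z (u k)"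
    using int_last_true[of "\<lambda>k. A z (u k)" "i + 1" r] z_next i by auto
  show ?thesis
  proof (cases "j = 0 \<and> l = 0")
    case True
    then have p2: "2 \<le> p" using nontriv p(4) by (meson leI order.trans zle_add1_eq_le)
    define u' where "u' k = (if k = 0 then z else u (p + k - 1))" for k
    have "prism A u' (r - p + 1) v s w t"
      unfolding prism_def
    proof (intro conjI ballI)
      show "ipath A u' (r - p + 1 + 1)"
        unfolding ipath_def
      proof (intro allI impI)
        fix a b assume ab: "0 \<le> a \<and> a < b \<and> b < r - p + 1 + 1"
        show "A (u' a) (u' b) \<longleftrightarrow> b = a + 1"
          using ab p(1) p(4)[of "p + b - 1"] P(10)[of "p + a - 1" "p + b - 1"] p2
          by (cases "a = 0"; cases "b = 1") (auto simp: u'_def)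
      qed
      show "A (u' a) (v b) \<longleftrightarrow> a = 0 \<and> b = 0 \<or> a = r - p + 1 \<and> b = s" if "a \<in> {0..r - p + 1}" "b \<in> {0..s}" for a b
        using that P(7)[of "p + a - 1" b] p p2 j(3) j(4)[of b] True by (cases "b = 0") (auto simp: u'_def)
      show "A (u' a) (w b) \<longleftrightarrow> a = 0 \<and> b = 0 \<or> a = r - p + 1 \<and> b = t" if "a \<in> {0..r - p + 1}" "b \<in> {0..t}" for a b
        using that P(9)[of "p + a - 1" b] p p2 l(3) l(4)[of b] True by (cases "b = 0") (auto simp: u'_def)
    qed (use P p in auto)
    from smallest[OF this] show ?thesis using p2 by simp
  next
    case False
    show ?thesis
    proof (rule ccontr)
      assume no: "\<not> ?thesis"
      show False
      proof (rule pyramid[OF sym noh, where z = z and p = "\<lambda>k. u (p + k)" and a = "r - p + 1"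
            and q = "\<lambda>k. v (j + k)" and b = "s - j + 1" and r = "\<lambda>k. w (l + k)" and c = "t - l + 1"])
        show "ipath A (\<lambda>k. u (p + k)) (r - p + 1)" using i p by (intro ipath_seg[OF P(4)]) auto
        show "ipath A (\<lambda>k. v (j + k)) (s - j + 1)" using j by (intro ipath_seg[OF P(5)]) auto
        show "ipath A (\<lambda>k. w (l + k)) (t - l + 1)" using l by (intro ipath_seg[OF P(6)]) auto
        have "\<not> (p = r \<and> j = s)" "\<not> (p = r \<and> l = t)" "\<not> (j = s \<and> l = t)" using no p(1) j(3) l(3) by auto
        then show "3 \<le> r - p + 1 + (s - j + 1)" "3 \<le> r - p + 1 + (t - l + 1)" "3 \<le> s - j + 1 + (t - l + 1)"
          using p j(1,2) l(1,2) by auto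
        show "A z (u (p + k)) \<longleftrightarrow> k = 0" if "0 \<le> k" "k < r - p + 1" for k
          using p(1) p(4)[of "p + k"] that by (cases "k = 0") auto
        show "A z (v (j + k)) \<longleftrightarrow> k = 0" if "0 \<le> k" "k < s - j + 1" for k
          using j(3) j(4)[of "j + k"] that by (cases "k = 0") auto
        show "A z (w (l + k)) \<longleftrightarrow> k = 0" if "0 \<le> k" "k < t - l + 1" for k
          using l(3) l(4)[of "l + k"] that by (cases "k = 0") auto
        show "A (u (p + a)) (v (j + b)) \<longleftrightarrow> a = r - p + 1 - 1 \<and> b = s - j + 1 - 1"
          if "0 \<le> a" "a < r - p + 1" "0 \<le> b" "b < s - j + 1" for a b
          using P(7)[of "p + a" "j + b"] that p(2,3) i j(1,2) by auto
        show "A (u (p + a)) (w (l + b)) \<longleftrightarrow> a = r - p + 1 - 1 \<and> b = t - l + 1 - 1"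
          if "0 \<le> a" "a < r - p + 1" "0 \<le> b" "b < t - l + 1" for a b
          using P(9)[of "p + a" "l + b"] that p(2,3) i l(1,2) by auto
        show "A (v (j + a)) (w (l + b)) \<longleftrightarrow> a = s - j + 1 - 1 \<and> b = t - l + 1 - 1"
          if "0 \<le> a" "a < s - j + 1" "0 \<le> b" "b < t - l + 1" for a b
          using P(8)[of "j + a" "l + b"] that j(1,2) l(1,2) False by auto
      qed (use p j l in auto)
    qed
  qed
qed

text \<open>If \<open>j\<close> is positive, the third path of the pyramid runs from the first
  neighbour \<open>u q\<close> back to \<open>u 0\<close> and then along \<open>w\<close>. If
  \<open>j = 0\<close>, the cycle from \<open>z\<close> along \<open>u\<close> can return to
  \<open>v 0\<close> along \<open>v\<close> or along \<open>w\<close>; the two lengths have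
  different parity because \<open>s + t\<close> is even, so one cycle is an odd hole.\<close>

lemma attach_one:
  assumes ipos: "0 < i" and z_prev: "A z (u (i - 1))"
    and j: "0 \<le> j" "j \<le> s" "A z (v j)" "\<And>k. j < k \<Longrightarrow> k \<le> s \<Longrightarrow> \<not> A z (v k)"
    and no_w: "\<And>k. 0 \<le> k \<Longrightarrow> k \<le> t \<Longrightarrow> \<not> A z (w k)"
  shows "A z (u r) \<and> A z (v s)"
proof -
  note P = prismD[OF pr]
  obtain p where p: "A z (u p)" "i + 1 \<le> p" "p \<le> r" "\<And>k. p < k \<Longrightarrow> k \<le> r \<Longrightarrow> \<not> A z (u k)"
    using int_last_true[of "\<lambda>k. A z (u k)" "i + 1" r] z_next i by auto
  obtain q where q: "A z (u q)" "0 \<le> q" "q \<le> i - 1" "\<And>k. 0 \<le> k \<Longrightarrow> k < q \<Longrightarrow> \<not> A z (u k)"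
    using int_first_true[of "\<lambda>k. A z (u k)" "i - 1" 0] z_prev ipos by auto
  have zp: "A z (u (p + k)) \<longleftrightarrow> k = 0" if "0 \<le> k" "k < r - p + 1" for k
    using p(1) p(4)[of "p + k"] that by (cases "k = 0") auto
  have pathp: "ipath A (\<lambda>k. u (p + k)) (r - p + 1)" using i p by (intro ipath_seg[OF P(4)]) auto
  show ?thesis
  proof (cases "j = 0")
    case True
    have zv: "A z (v k) \<longleftrightarrow> k = 0" if "0 \<le> k" "k \<le> s" for k
      using j(3) j(4)[of k] that True by (cases "k = 0") auto
    have "\<not> (even (r - p + 1 + (s + 1)) \<and> 4 \<le> r - p + 1 + (s + 1))"
    proof
      assume e: "even (r - p + 1 + (s + 1)) \<and> 4 \<le> r - p + 1 + (s + 1)"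
      have "r - p + s + 4 \<le> r - p + 1 + (s + 1) + 1"
      proof (rule odd_hole_two_paths[OF sym noh pathp P(5)])
        show "A (u (p + a)) (v b) \<longleftrightarrow> a = r - p + 1 - 1 \<and> b = s + 1 - 1"
          if "0 \<le> a" "a < r - p + 1" "0 \<le> b" "b < s + 1" for a b
          using P(7)[of "p + a" b] that p(2,3) i by auto
      qed (use e p P(2) zp zv in auto)
      then show False by simp
    qed
    moreover have "\<not> even (r - p + 1 + (t + 2))"
    proof
      assume e: "even (r - p + 1 + (t + 2))"
      define f where "f k = (if k = 0 then v 0 else w (k - 1))" for k
      have "r - p + t + 5 \<le> r - p + 1 + (t + 2) + 1"
      proof (rule odd_hole_two_paths[OF sym noh pathp, where q = f and z = z])
        show "ipath A f (t + 2)"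
          unfolding ipath_def
        proof (intro allI impI)
          fix a b assume ab: "0 \<le> a \<and> a < b \<and> b < t + 2"
          then show "A (f a) (f b) \<longleftrightarrow> b = a + 1"
            using P(8)[of 0 "b - 1"] P(12)[of "a - 1" "b - 1"] P(2) by (cases "a = 0") (auto simp: f_def)
        qed
        show "A z (f k) \<longleftrightarrow> k = 0" if "0 \<le> k" "k < t + 2" for k
          using that zv[of 0] no_w[of "k - 1"] P(2) by (auto simp: f_def)
        show "A (u (p + a)) (f b) \<longleftrightarrow> a = r - p + 1 - 1 \<and> b = t + 2 - 1"
          if "0 \<le> a" "a < r - p + 1" "0 \<le> b" "b < t + 2" for a b
          using P(7)[of "p + a" 0] P(9)[of "p + a" "b - 1"] that p(2,3) i P(2,3) by (auto simp: f_def)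
      qed (use e p P(3) zp in auto)
      then show False by simp
    qed
    moreover have "even (s + t)" using prism_parity[OF sym noh prism_rotate[OF sym pr]] .
    moreover have "1 \<le> s" "p \<le> r" using P(2) p by auto
    ultimately have False by presburger
    then show ?thesis ..
  next
    case False
    define f where "f k = (if k \<le> q then u (q - k) else w (k - q - 1))" for k
    show ?thesis
    proof (rule ccontr)
      assume no: "\<not> ?thesis"
      show False
      proof (rule pyramid[OF sym noh pathp, where z = z
            and q = "\<lambda>k. v (j + k)" and b = "s - j + 1" and r = f and c = "q + t + 2"])
        show "ipath A (\<lambda>k. v (j + k)) (s - j + 1)" using j by (intro ipath_seg[OF P(5)]) auto
        show "ipath A f (q + t + 2)"
          unfolding ipath_def
        proof (intro allI impI)
          fix a b assume ab: "0 \<le> a \<and> a < b \<and> b < q + t + 2"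
          consider "b \<le> q" | "a \<le> q" "q < b" | "q < a" by linarith
          then show "A (f a) (f b) \<longleftrightarrow> b = a + 1"
          proof cases
            case 1
            then show ?thesis using ab P(10)[of "q - b" "q - a"] A_com[of "u (q - a)"] q i by (auto simp: f_def)
          next
            case 2
            then show ?thesis using ab P(9)[of "q - a" "b - q - 1"] q i by (auto simp: f_def)
          next
            case 3
            then show ?thesis using ab P(12)[of "a - q - 1" "b - q - 1"] by (auto simp: f_def)
          qed
        qed
        have "\<not> (p = r \<and> j = s)" using no p(1) j(3) by auto
        then show "3 \<le> r - p + 1 + (s - j + 1)" using p j(1,2) by auto
        show "A z (v (j + k)) \<longleftrightarrow> k = 0" if "0 \<le> k" "k < s - j + 1" for k
          using j(3) j(4)[of "j + k"] that by (cases "k = 0") auto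
        show "A z (f k) \<longleftrightarrow> k = 0" if "0 \<le> k" "k < q + t + 2" for k
          using q(1,2) q(4)[of "q - k"] no_w[of "k - q - 1"] that by (cases "k = 0") (auto simp: f_def)
        show "A (u (p + a)) (v (j + b)) \<longleftrightarrow> a = r - p + 1 - 1 \<and> b = s - j + 1 - 1"
          if "0 \<le> a" "a < r - p + 1" "0 \<le> b" "b < s - j + 1" for a b
          using P(7)[of "p + a" "j + b"] that p(2,3) i j(1,2) by auto
        show "A (u (p + a)) (f b) \<longleftrightarrow> a = r - p + 1 - 1 \<and> b = q + t + 2 - 1"
          if "0 \<le> a" "a < r - p + 1" "0 \<le> b" "b < q + t + 2" for a b
          using P(10)[of "q - b" "p + a"] A_com[of "u (p + a)"] P(9)[of "p + a" "b - q - 1"] that p(2,3) q(2,3) i P(3)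
          by (auto simp: f_def)
        show "A (v (j + a)) (f b) \<longleftrightarrow> a = s - j + 1 - 1 \<and> b = q + t + 2 - 1"
          if "0 \<le> a" "a < s - j + 1" "0 \<le> b" "b < q + t + 2" for a b
          using P(7)[of "q - b" "j + a"] A_com[of "v (j + a)"] P(8)[of "j + a" "b - q - 1"] that q(2,3) i j(1,2) P(3) False
          by (auto simp: f_def)
      qed (use p q j P zp in auto)
    qed
  qed
qed

text \<open>\<open>z\<close> replaces the part of \<open>u\<close> strictly between its first and
  last neighbour. The neighbour \<open>u k\<close> guarantees that at least two vertices are
  dropped, so the prism gets smaller.\<close>

lemma attach_none:
  assumes ipos: "0 < i" and z_prev: "A z (u (i - 1))"
    and no_v: "\<And>k. 0 \<le> k \<Longrightarrow> k \<le> s \<Longrightarrow> \<not> A z (v k)" and no_w: "\<And>k. 0 \<le> k \<Longrightarrow> k \<le> t \<Longrightarrow> \<not> A z (w k)"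
    and nontriv: "0 \<le> k" "k \<le> r" "A z (u k)" "k \<notin> {i - 1, i, i + 1}"
  shows False
proof -
  note P = prismD[OF pr]
  obtain p where p: "A z (u p)" "i + 1 \<le> p" "p \<le> r" "\<And>k. p < k \<Longrightarrow> k \<le> r \<Longrightarrow> \<not> A z (u k)"
    using int_last_true[of "\<lambda>k. A z (u k)" "i + 1" r] z_next i by auto
  obtain q where q: "A z (u q)" "0 \<le> q" "q \<le> i - 1" "\<And>k. 0 \<le> k \<Longrightarrow> k < q \<Longrightarrow> \<not> A z (u k)"
    using int_first_true[of "\<lambda>k. A z (u k)" "i - 1" 0] z_prev ipos by auto
  have pq: "q + 2 < p" using p(2) p(4)[of k] q(3) q(4)[of k] nontriv by force
  define f where "f k = (if k \<le> q then u k else if k = q + 1 then z else u (p + k - q - 2))" for k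
  define r' where "r' = q + 2 + r - p"
  have "prism A f r' v s w t"
    unfolding prism_def
  proof (intro conjI ballI)
    show "ipath A f (r' + 1)"
      unfolding ipath_def
    proof (intro allI impI)
      fix a b assume ab: "0 \<le> a \<and> a < b \<and> b < r' + 1"
      consider "b \<le> q" | "a \<le> q" "b = q + 1" | "a \<le> q" "q + 1 < b" | "a = q + 1" | "q + 1 < a" using ab by linarith
      then show "A (f a) (f b) \<longleftrightarrow> b = a + 1"
      proof cases
        case 1 then show ?thesis using ab P(10)[of a b] q i by (auto simp: f_def)
      next
        case 2 then show ?thesis using ab q(1) q(4)[of a] A_com[of "u a" z] by (cases "a = q") (auto simp: f_def)
      next
        case 3 then show ?thesis using ab P(10)[of a "p + b - q - 2"] pq by (auto simp: f_def r'_def)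
      next
        case 4 then show ?thesis using ab p(1) p(4)[of "p + b - q - 2"] by (cases "b = q + 2") (auto simp: f_def r'_def)
      next
        case 5 then show ?thesis using ab P(10)[of "p + a - q - 2" "p + b - q - 2"] p(2) i by (auto simp: f_def r'_def)
      qed
    qed
    show "A (f a) (v b) \<longleftrightarrow> a = 0 \<and> b = 0 \<or> a = r' \<and> b = s" if "a \<in> {0..r'}" "b \<in> {0..s}" for a b
      using that P(7)[of a b] P(7)[of "p + a - q - 2" b] no_v[of b] p(2,3) q(2,3) i by (auto simp: f_def r'_def)
    show "A (f a) (w b) \<longleftrightarrow> a = 0 \<and> b = 0 \<or> a = r' \<and> b = t" if "a \<in> {0..r'}" "b \<in> {0..t}" for a b
      using that P(9)[of a b] P(9)[of "p + a - q - 2" b] no_w[of b] p(2,3) q(2,3) i by (auto simp: f_def r'_def)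
  qed (use P p q in \<open>auto simp: r'_def\<close>)
  from smallest[OF this] show False using pq by (simp add: r'_def)
qed

end

definition prism_verts :: "(int \<Rightarrow> 'v) \<Rightarrow> int \<Rightarrow> (int \<Rightarrow> 'v) \<Rightarrow> int \<Rightarrow> (int \<Rightarrow> 'v) \<Rightarrow> int \<Rightarrow> 'v set" where
  "prism_verts u r v s w t = u ` {0..r} \<union> v ` {0..s} \<union> w ` {0..t}"

text \<open>Domination supplies the neighbours that the three cases need: \<open>u (i + 1)\<close>,
  and \<open>u (i - 1)\<close> or, for \<open>i = 0\<close>, both \<open>v 0\<close> and
  \<open>w 0\<close>. Hence \<open>z\<close> can miss one of the other paths only if
  \<open>i\<close> is positive. The further neighbour \<open>q\<close> keeps \<open>z\<close> from
  being a mere substitute for \<open>u i\<close>.\<close>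

lemma attach:
  assumes sym: "symp A" and noh: "\<And>n. odd_holes_ge A n" and pr: "prism A u r v s w t"
    and smallest: "\<And>u' r' v' s' w' t'. prism A u' r' v' s' w' t' \<Longrightarrow> r + s + t \<le> r' + s' + t'"
    and i: "0 \<le> i" "i < r"
    and dom: "\<And>q. q \<in> prism_verts u r v s w t \<Longrightarrow> A (u i) q \<Longrightarrow> A z q"
    and extra: "q \<in> prism_verts u r v s w t" "A z q" "\<not> A (u i) q" "q \<noteq> u i"
  shows "A z (u r) \<and> A z (v s) \<or> A z (u r) \<and> A z (w t) \<or> A z (v s) \<and> A z (w t)"
proof -
  note P = prismD[OF pr]
  have com: "A x y \<longleftrightarrow> A y x" for x y using sym by (auto dest: sympD)
  have z_next: "A z (u (i + 1))" using dom[of "u (i + 1)"] P(10)[of i "i + 1"] i by (auto simp: prism_verts_def)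
  have z_prev: "A z (u (i - 1))" if "0 < i"
    using dom[of "u (i - 1)"] P(10)[of "i - 1" i] com[of "u i"] i that by (auto simp: prism_verts_def)
  have z_v: "A z (v 0)" if "i = 0" using dom[of "v 0"] P(7)[of 0 0] P(1-3) that by (auto simp: prism_verts_def)
  have z_w: "A z (w 0)" if "i = 0" using dom[of "w 0"] P(9)[of 0 0] P(1-3) that by (auto simp: prism_verts_def)
  have last_v: "\<exists>j. 0 \<le> j \<and> j \<le> s \<and> A z (v j) \<and> (\<forall>k. j < k \<and> k \<le> s \<longrightarrow> \<not> A z (v k))"
    if "0 \<le> a" "a \<le> s" "A z (v a)" for a
    using int_last_true[of "\<lambda>k. A z (v k)" a s] that by (metis order.trans)
  have last_w: "\<exists>j. 0 \<le> j \<and> j \<le> t \<and> A z (w j) \<and> (\<forall>k. j < k \<and> k \<le> t \<longrightarrow> \<not> A z (w k))"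
    if "0 \<le> a" "a \<le> t" "A z (w a)" for a
    using int_last_true[of "\<lambda>k. A z (w k)" a t] that by (metis order.trans)
  consider (both) a b where "0 \<le> a" "a \<le> s" "A z (v a)" "0 \<le> b" "b \<le> t" "A z (w b)"
    | (v) a where "0 \<le> a" "a \<le> s" "A z (v a)" "\<And>b. 0 \<le> b \<Longrightarrow> b \<le> t \<Longrightarrow> \<not> A z (w b)"
    | (w) b where "\<And>a. 0 \<le> a \<Longrightarrow> a \<le> s \<Longrightarrow> \<not> A z (v a)" "0 \<le> b" "b \<le> t" "A z (w b)"
    | (none) "\<And>a. 0 \<le> a \<Longrightarrow> a \<le> s \<Longrightarrow> \<not> A z (v a)" "\<And>b. 0 \<le> b \<Longrightarrow> b \<le> t \<Longrightarrow> \<not> A z (w b)"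
    by blast
  then show ?thesis
  proof cases
    case both
    obtain j l where j: "0 \<le> j" "j \<le> s" "A z (v j)" "\<forall>k. j < k \<and> k \<le> s \<longrightarrow> \<not> A z (v k)"
      and l: "0 \<le> l" "l \<le> t" "A z (w l)" "\<forall>k. l < k \<and> k \<le> t \<longrightarrow> \<not> A z (w k)"
      using last_v[OF both(1-3)] last_w[OF both(4-6)] by blast
    show ?thesis
    proof (rule attach_both[where j = j and l = l, OF sym noh pr smallest i z_next])
      assume jl: "j = 0" "l = 0"
      \<comment> \<open>For \<open>i = 0\<close> the further neighbour \<open>q\<close> lies neither
        on \<open>v\<close> nor on \<open>w\<close>, where \<open>z\<close> sees only the first
        vertices; so it lies on \<open>u\<close>, beyond \<open>u 1\<close>.\<close>
      show "\<exists>k\<ge>2. k \<le> r \<and> i < k \<and> A z (u k)"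
      proof (cases "i = 0")
        case False
        then show ?thesis using i z_next by (intro exI[of _ "i + 1"]) auto
      next
        case True
        have "q \<notin> v ` {0..s}"
        proof
          assume "q \<in> v ` {0..s}"
          then obtain k where k: "q = v k" "0 \<le> k" "k \<le> s" by auto
          then have "k = 0" using j(4) jl extra(2) by (metis order_le_less)
          then show False using extra(3) P(7)[of 0 0] P(1-3) k True by auto
        qed
        moreover have "q \<notin> w ` {0..t}"
        proof
          assume "q \<in> w ` {0..t}"
          then obtain k where k: "q = w k" "0 \<le> k" "k \<le> t" by auto
          then have "k = 0" using l(4) jl extra(2) by (metis order_le_less)
          then show False using extra(3) P(9)[of 0 0] P(1-3) k True by auto
        qed
        ultimately obtain k where k: "q = u k" "0 \<le> k" "k \<le> r" using extra(1) by (auto simp: prism_verts_def)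
        then have "k \<noteq> 0" "k \<noteq> 1" using extra(3,4) P(10)[of 0 1] P(1) True by auto
        then show ?thesis using k extra(2) True by (intro exI[of _ k]) auto
      qed
    qed (use j l in auto)
  next
    case v
    then have "0 < i" using z_w P(3) i by force
    obtain j where "0 \<le> j" "j \<le> s" "A z (v j)" "\<forall>k. j < k \<and> k \<le> s \<longrightarrow> \<not> A z (v k)"
      using last_v[OF v(1-3)] by blast
    then show ?thesis
      using attach_one[where j = j, OF sym noh pr smallest i z_next \<open>0 < i\<close> z_prev[OF \<open>0 < i\<close>]] v by auto
  next
    case w
    then have "0 < i" using z_v P(2) i by force
    have smallest': "r + t + s \<le> r' + s' + t'" if "prism A u' r' v' s' w' t'" for u' r' v' s' w' t'
      using smallest[OF that] by simp
    obtain j where "0 \<le> j" "j \<le> t" "A z (w j)" "\<forall>k. j < k \<and> k \<le> t \<longrightarrow> \<not> A z (w k)"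
      using last_w[OF w(2-4)] by blast
    then show ?thesis
      using attach_one[where j = j, OF sym noh prism_swap[OF sym pr] smallest' i z_next \<open>0 < i\<close> z_prev[OF \<open>0 < i\<close>]] w by auto
  next
    case none
    then have "0 < i" using z_v P(2) i by force
    obtain k where k: "q = u k" "0 \<le> k" "k \<le> r" using extra(1,2) none by (auto simp: prism_verts_def)
    then have "k \<notin> {i - 1, i, i + 1}"
      using extra P(10)[of "i - 1" i] P(10)[of i "i + 1"] com[of "u i"] \<open>0 < i\<close> i by auto
    then have False
      by (intro attach_none[where k = k and z = z, OF sym noh pr smallest i z_next \<open>0 < i\<close> z_prev[OF \<open>0 < i\<close>]])
        (use k extra(2) none in auto)
    then show ?thesis ..
  qed
qed

lemma prism_replace:
  assumes pr: "prism A u r v s w t" and sym: "symp A" and i: "0 \<le> i" "i \<le> r"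
    and u: "\<And>k. 0 \<le> k \<Longrightarrow> k \<le> r \<Longrightarrow> k \<noteq> i \<Longrightarrow> A z (u k) \<longleftrightarrow> A (u i) (u k)"
    and v: "\<And>k. 0 \<le> k \<Longrightarrow> k \<le> s \<Longrightarrow> A z (v k) \<longleftrightarrow> A (u i) (v k)"
    and w: "\<And>k. 0 \<le> k \<Longrightarrow> k \<le> t \<Longrightarrow> A z (w k) \<longleftrightarrow> A (u i) (w k)"
  shows "prism A (u(i := z)) r v s w t"
proof -
  note P = prismD[OF pr]
  have com: "A x y \<longleftrightarrow> A y x" for x y using sym by (auto dest: sympD)
  have "ipath A (u(i := z)) (r + 1)"
    unfolding ipath_def
  proof (intro allI impI)
    fix a b assume ab: "0 \<le> a \<and> a < b \<and> b < r + 1"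
    then show "A ((u(i := z)) a) ((u(i := z)) b) \<longleftrightarrow> b = a + 1"
      using P(10)[of a b] u[of a] u[of b] com[of "u a" z] com[of "u i" "u a"]
      by (cases "a = i"; cases "b = i") auto
  qed
  then show ?thesis using P v w i unfolding prism_def by auto
qed

section \<open>Contracted vertices in a smallest prism\<close>

definition path_weight :: "(int \<Rightarrow> 'a + 'a set) \<Rightarrow> int \<Rightarrow> nat" where
  "path_weight u r = (\<Sum>i\<in>{0..r}. weight (u i))"

lemma path_weight_rev: "path_weight (\<lambda>i. u (r - i)) r = path_weight u r"
  unfolding path_weight_def
  by (rule sum.reindex_bij_witness[of _ "\<lambda>i. r - i" "\<lambda>i. r - i"]) auto

text \<open>Two minimisations in this order: \<open>smallest\<close> makes \<open>attach\<close>
  available, and \<open>lightest\<close>, among prisms of the same size, prunes the contracted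
  sets.\<close>

locale min_prism = meyniel_rel E for E :: "'a \<Rightarrow> 'a \<Rightarrow> bool" +
  fixes u v w :: "int \<Rightarrow> 'a + 'a set" and r s t :: int
  assumes prism: "prism A u r v s w t"
    and smallest: "prism A u' r' v' s' w' t' \<Longrightarrow> r + s + t \<le> r' + s' + t'"
    and lightest: "prism A u' r' v' s' w' t' \<Longrightarrow> r' + s' + t' = r + s + t \<Longrightarrow>
      path_weight u r + path_weight v s + path_weight w t \<le> path_weight u' r' + path_weight v' s' + path_weight w' t'"
begin

lemmas P = prismD[OF prism]

lemma rotate: "min_prism E v w u s t r"
  by unfold_locales (use prism_rotate[OF symp_A prism] smallest lightest in force)+

lemma swap: "min_prism E u w v r t s"
  by unfold_locales (use prism_swap[OF symp_A prism] smallest lightest in force)+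

lemma reverse: "min_prism E (\<lambda>i. u (r - i)) (\<lambda>i. v (s - i)) (\<lambda>i. w (t - i)) r s t"
  by unfold_locales (use prism_reverse[OF symp_A prism] smallest lightest in \<open>auto simp: path_weight_rev\<close>)

abbreviation "V \<equiv> prism_verts u r v s w t"

lemma V_rotate: "prism_verts v s w t u r = V"
  by (auto simp: prism_verts_def)

lemma V_reverse: "prism_verts (\<lambda>i. u (r - i)) r (\<lambda>i. v (s - i)) s (\<lambda>i. w (t - i)) t = V"
proof -
  have "(\<lambda>i. f (a - i)) ` {0..a} = f ` {0..a}" for f :: "int \<Rightarrow> 'a + 'a set" and a
  proof -
    have "(\<lambda>i. f (a - i)) ` {0..a} = f ` ((\<lambda>i. a - i) ` {0..a})" by (simp only: image_image)
    also have "(\<lambda>i. a - i) ` {0..a} = {0..a}" by (simp add: image_diff_atLeastAtMost)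
    finally show ?thesis .
  qed
  then show ?thesis by (simp add: prism_verts_def)
qed

text \<open>Otherwise \<open>Inr B\<close> could replace \<open>u i\<close>, giving a prism of equal
  size and smaller weight.\<close>

lemma pruned:
  assumes C: "u i = Inr C" and B: "B \<subset> C" and i: "0 \<le> i" "i \<le> r"
  shows "\<exists>q\<in>V. A (Inr B) q \<and> \<not> A (u i) q \<and> q \<noteq> u i"
proof (rule ccontr)
  assume none: "\<not> ?thesis"
  have same: "A (Inr B) q \<longleftrightarrow> A (u i) q" if "q \<in> V" for q
  proof
    show "A (u i) q" if "A (Inr B) q" using none \<open>q \<in> V\<close> that C by auto
    show "A (Inr B) q" if "A (u i) q" using that C B A_antimono[of C q B] by auto
  qed
  have "prism A (u(i := Inr B)) r v s w t"
    by (rule prism_replace[OF prism symp_A i]; rule same) (auto simp: prism_verts_def)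
  then have "path_weight u r \<le> path_weight (u(i := Inr B)) r" using lightest by fastforce
  moreover have "path_weight (u(i := Inr B)) r < path_weight u r"
    unfolding path_weight_def
  proof (rule sum_strict_mono_ex1)
    have "\<exists>k\<in>{0..r}. A (u i) (u k)"
      using P(10)[of i "i + 1"] P(10)[of "i - 1" i] A_commute P(1) i by (cases "i = 0") (force, force)
    then have "finite C" using C by (metis contract_adj.simps(3,4) sum.exhaust)
    then have "card B < card C" using B by (rule psubset_card_mono)
    then show "\<forall>k\<in>{0..r}. weight ((u(i := Inr B)) k) \<le> weight (u k)"
      and "\<exists>k\<in>{0..r}. weight ((u(i := Inr B)) k) < weight (u k)"
      using C i by auto
  qed simp
  ultimately show False by simp
qed

lemma attach_u:
  assumes "0 \<le> i" "i < r" "\<And>q. q \<in> V \<Longrightarrow> A (u i) q \<Longrightarrow> A z q"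
    and "q \<in> V" "A z q" "\<not> A (u i) q" "q \<noteq> u i"
  shows "A z (u r) \<and> A z (v s) \<or> A z (u r) \<and> A z (w t) \<or> A z (v s) \<and> A z (w t)"
  by (rule attach[OF symp_A no_odd_holes prism smallest assms])

text \<open>The halves \<open>B\<close> and \<open>D\<close>, the edge from \<open>v s\<close> to \<open>w t\<close> and a common neighbour form a 5-hole.\<close>

lemma no_split:
  assumes i: "0 \<le> i" "i < r" and C: "u i = Inr (B \<union> D)"
    and BD: "A (Inr B) (u r)" "A (Inr B) (v s)" "A (Inr D) (u r)" "A (Inr D) (w t)"
  shows False
proof -
  \<comment> \<open>What both parts see is also seen by \<open>u i\<close>: this excludes
    \<open>w t\<close> and \<open>v s\<close> as common neighbours and puts \<open>u r\<close> next
    to \<open>u i\<close>.\<close>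
  have nB: "\<not> A (Inr B) (w t)" using A_union[of B "w t" D] BD(4) C P(9)[of i t] i P(1-3) by auto
  have nD: "\<not> A (Inr D) (v s)" using A_union[of B "v s" D] BD(2) C P(7)[of i s] i P(1-3) by auto
  have ir: "i = r - 1" using A_union[of B "u r" D] BD(1,3) C P(10)[of i r] i by auto
  have no_m: False if m: "m \<in> V" "A (u i) m" "\<not> A (v s) m" "\<not> A (w t) m" for m
  proof -
    have "A (Inr B) m" "A (Inr D) m" using m(2) C A_antimono[of "B \<union> D" m] by auto
    moreover have "A (v s) (w t)" using P(8)[of s t] P(1-3) by auto
    ultimately have "(6::int) \<le> 2 + 1 + 2"
      using BD nB nD m
      by (intro odd_hole_two_vertices[OF symp_A no_odd_holes, where z = "Inr B" and y = "Inr D"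
            and p = "\<lambda>k. if k = 0 then v s else w t" and q = "\<lambda>_. m"]) (auto simp: ipath_def)
    then show False by simp
  qed
  show False
  proof (cases "0 < i")
    case True
    show False
    proof (rule no_m[of "u (i - 1)"])
      show "A (u i) (u (i - 1))" using P(10)[of "i - 1" i] A_commute i True by auto
      show "\<not> A (v s) (u (i - 1))" using P(7)[of "i - 1" s] A_commute i True P(2) by auto
      show "\<not> A (w t) (u (i - 1))" using P(9)[of "i - 1" t] A_commute i True P(3) by auto
    qed (use i True in \<open>auto simp: prism_verts_def\<close>)
  next
    case False
    \<comment> \<open>Now \<open>v 0\<close> can serve as the common neighbour unless
      \<open>s = 1\<close>, and \<open>w 0\<close> unless \<open>t = 1\<close>. In the remaining
      prism on six vertices, all but \<open>u 0\<close> form a house; they are real, since each is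
      adjacent to a contracted vertex.\<close>
    then have i0: "i = 0" "r = 1" using i ir by auto
    have v0: "A (u 0) (v 0)" "A (u 0) (w 0)" using P(7)[of 0 0] P(9)[of 0 0] P(1-3) by auto
    have s1: "s = 1"
    proof (rule ccontr)
      assume "s \<noteq> 1"
      then have "2 \<le> s" using P(2) by simp
      then show False using no_m[of "v 0"] v0 i0 P(11)[of 0 s] A_commute P(8)[of 0 t] P(2,3)
        by (auto simp: prism_verts_def)
    qed
    have t1: "t = 1"
    proof (rule ccontr)
      assume "t \<noteq> 1"
      then have "2 \<le> t" using P(3) by simp
      then show False using no_m[of "w 0"] v0 i0 P(12)[of 0 t] A_commute P(8)[of s 0] P(2,3)
        by (auto simp: prism_verts_def)
    qed
    obtain a b c d e where abc: "u 1 = Inl a" "v 1 = Inl b" "w 1 = Inl c" "v 0 = Inl d" "w 0 = Inl e"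
      using BD v0 C i0 s1 t1 by (cases "u 1"; cases "v 1"; cases "w 1"; cases "v 0"; cases "w 0") auto
    have E: "E a b" "E a c" "E b c" "\<not> E a d" "\<not> E a e" "E d e" "E b d" "E c e" "\<not> E b e" "\<not> E c d"
      using P(7)[of 1 1] P(9)[of 1 1] P(8)[of 1 1] P(7)[of 1 0] P(9)[of 1 0] P(8)[of 0 0]
        P(11)[of 0 1] P(12)[of 0 1] P(8)[of 1 0] P(8)[of 0 1] i0 s1 t1 abc sym by auto
    show False
      by (rule roof[of b c a "[e, d]"]) (use E sym in auto)
  qed
qed

text \<open>Each of \<open>{x}\<close> and its complement in \<open>C\<close> sees two vertices of
  the triangle at \<open>u r\<close>. They cannot share \<open>v s\<close> or \<open>w t\<close>, so
  both see \<open>u r\<close> and divide the other two, which \<open>no_split\<close>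
  forbids.\<close>

lemma single_u_less:
  assumes i: "0 \<le> i" "i < r" shows "single (u i)"
  unfolding single_def
proof (intro allI impI)
  fix C assume C: "u i = Inr C"
  have "C \<noteq> {}"
  proof
    assume "C = {}"
    have "A (v s) (w t)" using P(8)[of s t] P(1-3) by auto
    then have "isl (v s) \<or> isl (w t)" by (rule A_isl)
    then show False using A_Inr_empty C \<open>C = {}\<close> P(7)[of i s] P(9)[of i t] i P(1-3) by auto
  qed
  then obtain x where x: "x \<in> C" by auto
  show "\<exists>x. C = {x}"
  proof (rule ccontr)
    assume ns: "\<not> ?thesis"
    define D where "D = C - {x}"
    have D: "{x} \<subset> C" "D \<subset> C" "C = {x} \<union> D" "C = D \<union> {x}" using x ns by (auto simp: D_def)
    have two: "A (Inr B) (u r) \<and> A (Inr B) (v s) \<or> A (Inr B) (u r) \<and> A (Inr B) (w t) \<or>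
      A (Inr B) (v s) \<and> A (Inr B) (w t)" if B: "B \<subset> C" for B
    proof -
      obtain q where q: "q \<in> V" "A (Inr B) q" "\<not> A (u i) q" "q \<noteq> u i" using pruned[OF C B] i by auto
      show ?thesis by (rule attach_u[OF i _ q]) (use A_antimono[of C _ B] B C in auto)
    qed
    have "\<not> (A (Inr {x}) (v s) \<and> A (Inr D) (v s))"
      using A_union[of "{x}" "v s" D] C D(3) P(7)[of i s] i P(1-3) by auto
    moreover have "\<not> (A (Inr {x}) (w t) \<and> A (Inr D) (w t))"
      using A_union[of "{x}" "w t" D] C D(3) P(9)[of i t] i P(1-3) by auto
    ultimately show False
      using two[OF D(1)] two[OF D(2)] no_split[OF i, of "{x}" D] no_split[OF i, of D "{x}"] C D(3,4) by metis
  qed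
qed

lemma single_u: "0 \<le> i \<Longrightarrow> i \<le> r \<Longrightarrow> single (u i)"
  using single_u_less[of i] min_prism.single_u_less[OF reverse, of 0] P(1) by (cases "i = r") auto

lemma all_single: assumes "q \<in> V" shows "single q"
  using assms single_u min_prism.single_u[OF rotate] min_prism.single_u[OF min_prism.rotate[OF rotate]]
  by (auto simp: prism_verts_def)

text \<open>The real \<open>y\<close> sees everything that \<open>Inr {y}\<close> sees and in
  addition the contracted \<open>q\<close>, so \<open>attach\<close> applies. If it sees
  \<open>v s\<close> or \<open>w t\<close>, that vertex is contracted, as \<open>u i\<close> misses
  it; but adjacent vertices are not both contracted. So \<open>y\<close> sees \<open>u r\<close>,
  which is real and hence a neighbour of \<open>u i\<close>.\<close>

lemma contracted_edge_end:
  assumes i: "0 \<le> i" "i < r" and y: "u i = Inr {y}" and q: "q \<in> V" "\<not> isl q" "A (Inl y) q"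
  shows "i = r - 1" and "\<not> isl (v s) \<and> A (Inl y) (v s) \<or> \<not> isl (w t) \<and> A (Inl y) (w t)"
proof -
  have real: "A (Inl y) p \<longleftrightarrow> A (u i) p" if "isl p" for p using A_Inr_single[OF that] y by simp
  have "A (Inl y) (u r) \<and> A (Inl y) (v s) \<or> A (Inl y) (u r) \<and> A (Inl y) (w t) \<or> A (Inl y) (v s) \<and> A (Inl y) (w t)"
  proof (rule attach_u[OF i _ q(1,3)])
    show "A (Inl y) p" if "p \<in> V" "A (u i) p" for p using real that y A_isl[of "u i" p] by auto
    show "\<not> A (u i) q" using y q(2) by (cases q) auto
    show "q \<noteq> u i" using q(3) y irrefl by auto
  qed
  moreover have "\<not> isl (v s)" if "A (Inl y) (v s)" using real[of "v s"] that P(7)[of i s] i P(1-3) by auto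
  moreover have "\<not> isl (w t)" if "A (Inl y) (w t)" using real[of "w t"] that P(9)[of i t] i P(1-3) by auto
  moreover have "isl (v s) \<or> isl (w t)" using A_isl[of "v s" "w t"] P(8)[of s t] P(1-3) by auto
  moreover have "isl (u r) \<or> isl (v s)" using A_isl[of "u r" "v s"] P(7)[of r s] P(1-3) by auto
  moreover have "isl (u r) \<or> isl (w t)" using A_isl[of "u r" "w t"] P(9)[of r t] P(1-3) by auto
  moreover have "i = r - 1" if "A (Inl y) (u r)" "isl (u r)" using real[of "u r"] that P(10)[of i r] i by auto
  ultimately show "i = r - 1" "\<not> isl (v s) \<and> A (Inl y) (v s) \<or> \<not> isl (w t) \<and> A (Inl y) (w t)" by metis+
qed

lemma E_rep: "A p q \<Longrightarrow> p \<in> V \<Longrightarrow> q \<in> V \<Longrightarrow> E (rep p) (rep q)"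
  using A_rep[of p q] all_single A_isl by blast

text \<open>\<open>v 0\<close> is the roof over the edge from \<open>u 0\<close> to
  \<open>w 0\<close>; the walk runs along \<open>w\<close> to the other triangle and back along
  \<open>u\<close>. Stating the hypotheses for representatives allows a use before all edges between
  contracted elements are excluded.\<close>

lemma no_roof:
  assumes w: "\<And>k. 1 \<le> k \<Longrightarrow> k \<le> t \<Longrightarrow> \<not> E (rep (v 0)) (rep (w k)) \<and>
      \<not> (E (rep (u 0)) (rep (w k)) \<and> E (rep (w 0)) (rep (w k)))"
    and u: "\<And>k. 1 \<le> k \<Longrightarrow> k \<le> r \<Longrightarrow> \<not> E (rep (v 0)) (rep (u k)) \<and>
      \<not> (E (rep (u 0)) (rep (u k)) \<and> E (rep (w 0)) (rep (u k)))"
  shows False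
proof -
  let ?w = "\<lambda>k. rep (w k)" and ?u = "\<lambda>k. rep (u k)"
  have inV: "w k \<in> V" if "0 \<le> k" "k \<le> t" for k using that by (auto simp: prism_verts_def)
  have inV': "u k \<in> V" if "0 \<le> k" "k \<le> r" for k using that by (auto simp: prism_verts_def)
  have v0: "v 0 \<in> V" using P(2) by (auto simp: prism_verts_def)
  show False
  proof (rule roof[of "?u 0" "?w 0" "rep (v 0)" "map ?w [1..t] @ rev (map ?u [1..r])"])
    show "E (?u 0) (?w 0)" using E_rep[OF _ inV' inV] P(9)[of 0 0] P(1-3) by auto
    show "E (rep (v 0)) (?u 0)" using E_rep[OF _ v0 inV'] P(7)[of 0 0] A_commute P(1-3) by auto
    show "E (rep (v 0)) (?w 0)" using E_rep[OF _ v0 inV] P(8)[of 0 0] P(1-3) by auto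
    show "map ?w [1..t] @ rev (map ?u [1..r]) \<noteq> []" using P(3) by simp
    have W: "successively E (map ?w [0..t])"
      unfolding successively_map successively_conv_nth using E_rep[OF _ inV inV] P(12) by auto
    have U: "successively (\<lambda>x y. E y x) (map ?u [0..r])"
      unfolding successively_map successively_conv_nth using E_rep[OF _ inV' inV'] P(10) sym by auto
    have "successively E (map ?w [0..t] @ rev (map ?u [0..r]))"
    proof -
      have "last (map ?w [0..t]) = ?w t" "hd (rev (map ?u [0..r])) = ?u r"
        using P(1,3) by (auto simp: upto_rec2 hd_rev)
      moreover have "E (?w t) (?u r)" using E_rep[OF _ inV inV'] P(9)[of r t] A_commute P(1-3) by auto
      ultimately show ?thesis using W U by (auto simp: successively_append_iff)
    qed
    moreover have "map ?w [0..t] = ?w 0 # map ?w [1..t]" "map ?u [0..r] = ?u 0 # map ?u [1..r]"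
      using upto_rec1[of 0 t] upto_rec1[of 0 r] P(1,3) by auto
    ultimately show "successively E (?w 0 # (map ?w [1..t] @ rev (map ?u [1..r])) @ [?u 0])" by simp
  qed (use u w in auto)
qed

text \<open>The edge from \<open>y\<close> to the element of \<open>v s\<close> can be read from
  both ends and in both directions of the prism, and each reading through
  \<open>contracted_edge_end\<close> fixes a position. Together with \<open>prism_parity\<close>
  only \<open>r = s = 1\<close> with \<open>t\<close> odd is left, where \<open>no_roof\<close>
  applies.\<close>

lemma no_contracted_edge_v:
  assumes i: "0 \<le> i" "i < r" and y: "u i = Inr {y}" and vs: "\<not> isl (v s)" "A (Inl y) (v s)"
  shows False
proof -
  have inV: "u k \<in> V" if "0 \<le> k" "k \<le> r" for k using that by (auto simp: prism_verts_def)
  have vsV: "v s \<in> V" using P(2) by (auto simp: prism_verts_def)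
  obtain y' where y': "v s = Inr {y'}" using all_single[OF vsV] vs(1) by (cases "v s") (auto simp: single_def)
  have yy: "E y y'" using vs(2) y' by simp
  have ir: "i = r - 1" using contracted_edge_end(1)[OF i y vsV vs] .
  interpret rv: min_prism E "\<lambda>i. v (s - i)" "\<lambda>i. w (t - i)" "\<lambda>i. u (r - i)" s t r
    using min_prism.reverse[OF rotate] .
  have Vrv: "rv.V = V" using min_prism.V_reverse[OF rotate] V_rotate by simp
  have s1: "s = 1"
    using rv.contracted_edge_end(1)[of 0 y' "u i"] P(2) y' y inV[of i] i sym[OF yy] Vrv by auto
  have par: "even (r + s)" "even (r + t)"
    using prism_parity[OF symp_A no_odd_holes prism]
      prism_parity[OF symp_A no_odd_holes prism_swap[OF symp_A prism]] by auto
  interpret ru: min_prism E "\<lambda>i. u (r - i)" "\<lambda>i. v (s - i)" "\<lambda>i. w (t - i)" r s t by (rule reverse)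
  \<comment> \<open>For positive \<open>i\<close> the reversed prism would give
    \<open>i = 1\<close>, hence \<open>r = 2\<close>, against \<open>s = 1\<close> and the equal
    parities.\<close>
  have i0: "i = 0"
  proof (rule ccontr)
    assume "i \<noteq> 0"
    then have "r - i = r - 1"
      using ru.contracted_edge_end(1)[of "r - i" y "v s"] y vs vsV i V_reverse by auto
    then show False using ir par s1 by simp
  qed
  then have r1: "r = 1" using ir by simp
  have v0: "isl (v 0)" "isl (w 0)"
    using A_isl[of "u 0" "v 0"] A_isl[of "u 0" "w 0"] P(7)[of 0 0] P(9)[of 0 0] P(1-3) y i0 by auto
  have vw0: "v 0 \<in> V" "w 0 \<in> V" using P(2,3) by (auto simp: prism_verts_def)
  have wV: "w k \<in> V" if "0 \<le> k" "k \<le> t" for k using that by (auto simp: prism_verts_def)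
  have adj_v: "E (rep (v 0)) (rep q) \<longleftrightarrow> A (v 0) q" if "q \<in> V" for q
    using A_rep[of "v 0" q] all_single that vw0 v0 by auto
  have adj_w: "E (rep (w 0)) (rep q) \<longleftrightarrow> A (w 0) q" if "q \<in> V" for q
    using A_rep[of "w 0" q] all_single that vw0 v0 by auto
  \<comment> \<open>\<open>y\<close> and \<open>w 0\<close> must have no common neighbour on
    \<open>w\<close>. If \<open>y\<close> saw \<open>w 1\<close>, this vertex would be contracted,
    and reading the edge from there would give \<open>t = 2\<close>, against
    \<open>r = 1\<close>.\<close>
  have w1: "\<not> E y (rep (w 1))"
  proof
    assume e: "E y (rep (w 1))"
    have w1V: "w 1 \<in> V" using wV[of 1] P(3) by simp
    have Aw1: "A (Inl y) (w 1)" using A_Inl_rep[OF all_single[OF w1V]] e by simp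
    have con: "\<not> isl (w 1)" using Aw1 A_Inr_single[of "w 1" y] P(9)[of 0 1] P(1-3) y i0 r1 by auto
    have "t \<noteq> 1" using con A_isl[of "v s" "w t"] P(8)[of s t] P(2,3) vs(1) by auto
    then have "1 < t" using P(3) by simp
    obtain y2 where y2: "w 1 = Inr {y2}" using all_single[OF w1V] con by (cases "w 1") (auto simp: single_def)
    interpret rw: min_prism E w u v t r s using min_prism.rotate[OF rotate] .
    have "rw.V = V" by (auto simp: prism_verts_def)
    then have "1 = t - 1"
      using rw.contracted_edge_end(1)[of 1 y2 "u 0"] y2 y i0 inV[of 0] \<open>1 < t\<close> P(1) Aw1 sym by auto
    then show False using par r1 by simp
  qed
  show False
  proof (rule no_roof)
    fix k assume k: "1 \<le> k" "k \<le> t"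
    show "\<not> E (rep (v 0)) (rep (w k)) \<and> \<not> (E (rep (u 0)) (rep (w k)) \<and> E (rep (w 0)) (rep (w k)))"
      using adj_v[OF wV, of k] adj_w[OF wV, of k] P(8)[of 0 k] P(12)[of 0 k] k P(2) w1 y i0 by auto
  next
    fix k assume k: "1 \<le> k" "k \<le> r"
    then have "k = 1" using r1 by simp
    then show "\<not> E (rep (v 0)) (rep (u k)) \<and> \<not> (E (rep (u 0)) (rep (u k)) \<and> E (rep (w 0)) (rep (u k)))"
      using adj_v[OF inV, of 1] adj_w[OF inV, of 1] P(7)[of 1 0] P(9)[of 1 0] A_commute r1 P(2,3) by auto
  qed
qed

lemma no_contracted_edge_less:
  assumes i: "0 \<le> i" "i < r" and y: "u i = Inr {y}" and q: "q \<in> V" "\<not> isl q"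
  shows "\<not> A (Inl y) q"
proof
  assume "A (Inl y) q"
  then have "\<not> isl (v s) \<and> A (Inl y) (v s) \<or> \<not> isl (w t) \<and> A (Inl y) (w t)"
    using contracted_edge_end(2)[OF i y q] by simp
  then show False using no_contracted_edge_v[OF i y] min_prism.no_contracted_edge_v[OF swap i y] by blast
qed

lemma no_contracted_edge_u:
  assumes i: "0 \<le> i" "i \<le> r" and y: "u i = Inr {y}" and q: "q \<in> V" "\<not> isl q"
  shows "\<not> A (Inl y) q"
  using no_contracted_edge_less[OF i(1) _ y q] min_prism.no_contracted_edge_less[OF reverse, of 0 y q]
    y q V_reverse P(1) i by (cases "i = r") auto

lemma no_contracted_edge:
  assumes "p \<in> V" "p = Inr {y}" "q \<in> V" "\<not> isl q" shows "\<not> A (Inl y) q"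
proof -
  have V2: "prism_verts w t u r v s = V" by (auto simp: prism_verts_def)
  consider i where "0 \<le> i" "i \<le> r" "u i = Inr {y}" | i where "0 \<le> i" "i \<le> s" "v i = Inr {y}"
    | i where "0 \<le> i" "i \<le> t" "w i = Inr {y}" using assms(1,2) by (auto simp: prism_verts_def)
  then show ?thesis
    by cases (use assms(3,4) no_contracted_edge_u min_prism.no_contracted_edge_u[OF rotate]
      min_prism.no_contracted_edge_u[OF min_prism.rotate[OF rotate]] V_rotate V2 in auto)
qed

lemma contradiction: False
proof -
  \<comment> \<open>With these edges excluded, \<open>rep\<close> preserves adjacency and
    nonadjacency, so the prism lies in the Meyniel graph and contains a house.\<close>
  have E_V: "E (rep p) (rep q) \<longleftrightarrow> A p q" if pq: "p \<in> V" "q \<in> V" for p q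
  proof (cases "isl p \<or> isl q")
    case True then show ?thesis using A_rep all_single pq by blast
  next
    case False
    then obtain x where x: "p = Inr {x}" using all_single[OF pq(1)] by (cases p) (auto simp: single_def)
    show ?thesis
      using no_contracted_edge[OF pq(1) x pq(2)] False A_Inl_rep[OF all_single[OF pq(2)], of x] x by (cases q) auto
  qed
  have inV: "u k \<in> V" if "0 \<le> k" "k \<le> r" for k using that by (auto simp: prism_verts_def)
  have inV': "w k \<in> V" if "0 \<le> k" "k \<le> t" for k using that by (auto simp: prism_verts_def)
  have v0: "v 0 \<in> V" using P(2) by (auto simp: prism_verts_def)
  show False
  proof (rule no_roof)
    fix k assume k: "1 \<le> k" "k \<le> t"
    show "\<not> E (rep (v 0)) (rep (w k)) \<and> \<not> (E (rep (u 0)) (rep (w k)) \<and> E (rep (w 0)) (rep (w k)))"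
      using E_V[OF v0 inV', of k] E_V[OF inV inV', of 0 k] P(8)[of 0 k] P(9)[of 0 k] k P(1-3) by auto
  next
    fix k assume k: "1 \<le> k" "k \<le> r"
    show "\<not> E (rep (v 0)) (rep (u k)) \<and> \<not> (E (rep (u 0)) (rep (u k)) \<and> E (rep (w 0)) (rep (u k)))"
      using E_V[OF v0 inV, of k] E_V[OF inV' inV, of 0 k] P(7)[of k 0] P(9)[of k 0] A_commute k P(1-3) by auto
  qed
qed

end

section \<open>Excluding prisms and antiholes\<close>

context meyniel_rel
begin

lemma no_prism: "\<not> prism A u r v s w t"
proof
  assume pr: "prism A u r v s w t"
  define P where "P = (\<lambda>(u, r, v, s, w, t). prism A u r v s w t)"
  define size where "size = (\<lambda>(u :: int \<Rightarrow> 'a + 'a set, r :: int, v :: int \<Rightarrow> 'a + 'a set, s :: int,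
    w :: int \<Rightarrow> 'a + 'a set, t :: int). nat (r + s + t))"
  define wt where "wt = (\<lambda>(u :: int \<Rightarrow> 'a + 'a set, r, v :: int \<Rightarrow> 'a + 'a set, s,
    w :: int \<Rightarrow> 'a + 'a set, t). path_weight u r + path_weight v s + path_weight w t)"
  define X where "X = (ARG_MIN size X. P X)"
  have X: "P X" "\<And>Y. P Y \<Longrightarrow> size X \<le> size Y"
    using arg_min_nat_lemma[of P "(u, r, v, s, w, t)" size] pr by (auto simp: X_def P_def)
  define Y where "Y = (ARG_MIN wt Y. P Y \<and> size Y = size X)"
  have Y: "P Y \<and> size Y = size X" "\<And>Z. P Z \<and> size Z = size X \<Longrightarrow> wt Y \<le> wt Z"
    using arg_min_nat_lemma[of "\<lambda>Y. P Y \<and> size Y = size X" X wt] X(1) by (auto simp: Y_def)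
  obtain u r v s w t where Y_eq: "Y = (u, r, v, s, w, t)" by (cases Y) auto
  have "min_prism E u v w r s t"
  proof
    show pr: "prism A u r v s w t" using Y(1) by (simp add: P_def Y_eq)
    fix u' r' v' s' w' t' assume pr': "prism A u' r' v' s' w' t'"
    then have P': "P (u', r', v', s', w', t')" by (simp add: P_def)
    have "size Y \<le> size (u', r', v', s', w', t')" using X(2)[OF P'] Y(1) by simp
    then show "r + s + t \<le> r' + s' + t'"
      using prismD(1-3)[OF pr] prismD(1-3)[OF pr'] by (simp add: size_def Y_eq)
    assume "r' + s' + t' = r + s + t"
    then have "size (u', r', v', s', w', t') = size X" using Y(1) by (simp add: size_def Y_eq)
    then have "wt Y \<le> wt (u', r', v', s', w', t')" using Y(2) P' by blast
    then show "path_weight u r + path_weight v s + path_weight w t \<le> path_weight u' r' + path_weight v' s' + path_weight w' t'"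
      by (simp add: wt_def Y_eq)
  qed
  then show False by (rule min_prism.contradiction)
qed

lemma no_antihole:
  fixes n :: int and g :: "int \<Rightarrow> 'a + 'a set"
  assumes n: "5 \<le> n" and g: "\<And>i j. A (g i) (g j) \<longleftrightarrow> (j - i) mod n \<notin> {0, 1, n - 1}"
  shows False
proof -
  consider "n = 5" | "n = 6" | "7 \<le> n" using n by linarith
  then show False
  proof cases
    \<comment> \<open>The 5-cycle is isomorphic to its complement; steps of 2 modulo 5 run through
      the complementary cycle.\<close>
    case 1
    have "ipath A (\<lambda>k. g (2 * k + 2)) 4"
      unfolding ipath_def
    proof (intro allI impI)
      fix i j :: int assume ij: "0 \<le> i \<and> i < j \<and> j < 4"
      then have "j = i + 1 \<or> j = i + 2 \<or> j = i + 3" by linarith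
      then show "A (g (2 * i + 2)) (g (2 * j + 2)) \<longleftrightarrow> j = i + 1"
        by (elim disjE) (simp_all add: g 1)
    qed
    moreover have "A (g 0) (g (2 * k + 2)) \<longleftrightarrow> k = 0 \<or> k = 4 - 1" if "0 \<le> k \<and> k < 4" for k
    proof -
      have "k = 0 \<or> k = 1 \<or> k = 2 \<or> k = 3" using that by linarith
      then show ?thesis using g[of 0 "2 * k + 2"] 1 by auto
    qed
    ultimately have "odd_hole A (g 0) (\<lambda>k. g (2 * k + 2)) 4" by (auto simp: odd_hole_def)
    then show False using no_odd_hole by blast
  next
    \<comment> \<open>The complement of a 6-cycle is the prism with triangles 0, 2, 4 and 3, 5, 1,
      whose paths are the edges between opposite vertices.\<close>
    case 2
    have 01: "{0..1} = {0, 1 :: int}" by auto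
    have path: "ipath A (\<lambda>k. g (c + 3 * k)) (1 + 1)" for c
      unfolding ipath_def
    proof (intro allI impI)
      fix i j :: int assume "0 \<le> i \<and> i < j \<and> j < 1 + 1"
      then have "i = 0" "j = 1" by linarith+
      then show "A (g (c + 3 * i)) (g (c + 3 * j)) \<longleftrightarrow> j = i + 1" using g 2 by simp
    qed
    have "prism A (\<lambda>k. g (0 + 3 * k)) 1 (\<lambda>k. g (2 + 3 * k)) 1 (\<lambda>k. g (4 + 3 * k)) 1"
      unfolding prism_def 01 using path[of 0] path[of 2] path[of 4] by (simp add: g 2)
    then show False using no_prism by blast
  next
    case 3
    have adj: "A (g i) (g j) \<longleftrightarrow> j \<noteq> i + 1" if "i < j" "j \<le> i + 5" for i j
    proof -
      have "(j - i) mod n = j - i" using that 3 by simp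
      then show ?thesis using g[of i j] that 3 by auto
    qed
    \<comment> \<open>All of \<open>k + 2\<close>, ..., \<open>k + 5\<close> are adjacent to a
      contracted \<open>g k\<close> and thus real. The fifth vertex is \<open>k + 1\<close> or, if
      that is contracted, \<open>k + 6\<close>, which is adjacent to it.\<close>
    obtain m where m: "isl (g (m + j))" if "0 \<le> j" "j \<le> 4" for j
    proof (cases "\<forall>i. isl (g i)")
      case True then show ?thesis using that[of 0] by auto
    next
      case False
      then obtain k where k: "\<not> isl (g k)" by auto
      have *: "isl (g j)" if "k + 2 \<le> j" "j \<le> k + 5" for j
        using adj[of k j] that A_isl[of "g k" "g j"] k by auto
      show ?thesis
      proof (cases "isl (g (k + 1))")
        case True
        have "isl (g (k + 1 + j))" if "0 \<le> j" "j \<le> 4" for j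
          using * [of "k + 1 + j"] True that by (cases "j = 0") auto
        then show ?thesis using that by blast
      next
        case False
        have "isl (g (k + 2 + j))" if "0 \<le> j" "j \<le> 4" for j
          using * [of "k + 2 + j"] False that adj[of "k + 1" "k + 6"] A_isl[of "g (k + 1)" "g (k + 6)"]
          by (cases "j = 4") (auto simp: add.commute)
        then show ?thesis using that by blast
      qed
    qed
    define a where "a j = rep (g (m + j))" for j
    have E_a: "E (a i) (a j) \<longleftrightarrow> j \<noteq> i + 1" if "0 \<le> i" "i < j" "j \<le> 4" for i j
      using adj[of "m + i" "m + j"] m[of i] m[of j] that
      by (cases "g (m + i)"; cases "g (m + j)") (auto simp: a_def)
    \<comment> \<open>The complement of a path on five vertices is a house with the middle vertex as
      roof.\<close>
    show False
      by (rule roof[of "a 0" "a 4" "a 2" "[a 1, a 3]"])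
        (use E_a[of 0 4] E_a[of 0 2] E_a[of 2 4] E_a[of 1 4] E_a[of 1 3] E_a[of 0 3] E_a[of 1 2] E_a[of 2 3]
          E_a[of 0 1] E_a[of 3 4] sym in auto)
  qed
qed

end

section \<open>Cycles, simple graphs and holes given by vertex sequences\<close>

lemma set_vwalk_arcs: "set (vwalk_arcs p) = {(p ! i, p ! Suc i) | i. Suc i < length p}"
proof (induction p rule: vwalk_arcs.induct)
  case (3 x y xs)
  show ?case (is "?L = ?R")
  proof -
    have "?R = {(x, y)} \<union> {((y # xs) ! i, (y # xs) ! Suc i) | i. Suc i < length (y # xs)}"
    proof (intro set_eqI iffI)
      fix e assume "e \<in> ?R"
      then obtain i where "e = ((x # y # xs) ! i, (x # y # xs) ! Suc i)" "Suc i < length (x # y # xs)" by auto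
      then show "e \<in> {(x, y)} \<union> {((y # xs) ! i, (y # xs) ! Suc i) | i. Suc i < length (y # xs)}"
        by (cases i) auto
    next
      fix e assume "e \<in> {(x, y)} \<union> {((y # xs) ! i, (y # xs) ! Suc i) | i. Suc i < length (y # xs)}"
      then consider "e = (x, y)" | i where "e = ((y # xs) ! i, (y # xs) ! Suc i)" "Suc i < length (y # xs)" by blast
      then show "e \<in> ?R"
      proof cases
        case 1 then show ?thesis by (auto intro!: exI[of _ 0])
      next
        case 2 then show ?thesis by (auto intro!: exI[of _ "Suc i"])
      qed
    qed
    then show ?thesis using 3 by simp
  qed
qed auto

lemma cycle_arcs_conv:
  assumes "p \<noteq> []"
  shows "cycle_arcs p = insert (last p, hd p) (set (vwalk_arcs p))"
  using assms vwalk_arcs_append[of p "[hd p]"] by (auto simp: cycle_arcs_def)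

lemma cycle_arcs_nth:
  assumes p: "distinct p" "i < length p" "j < length p"
  shows "(p ! i, p ! j) \<in> cycle_arcs p \<longleftrightarrow> j = Suc i \<or> i = length p - 1 \<and> j = 0"
proof -
  have "p \<noteq> []" using p by auto
  moreover have "(p ! i, p ! j) \<in> set (vwalk_arcs p) \<longleftrightarrow> j = Suc i"
    using p unfolding set_vwalk_arcs by (auto simp: nth_eq_iff_index_eq)
  ultimately show ?thesis
    using p by (auto simp: cycle_arcs_conv last_conv_nth hd_conv_nth nth_eq_iff_index_eq)
qed

lemma pair_graph_sym: "pair_graph G \<Longrightarrow> (x, y) \<in> parcs G \<Longrightarrow> (y, x) \<in> parcs G"
proof -
  assume "pair_graph G" and xy: "(x, y) \<in> parcs G"
  then interpret pair_graph G by simp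
  show ?thesis using sym_arcs xy by (simp add: symmetric_def symD)
qed

lemma pair_graph_irrefl: "pair_graph G \<Longrightarrow> (x, x) \<notin> parcs G"
proof
  assume "pair_graph G" and xx: "(x, x) \<in> parcs G"
  then interpret pair_graph G by simp
  show False using pair_no_loops[OF xx] by simp
qed

lemma pair_graph_verts: "pair_graph G \<Longrightarrow> (x, y) \<in> parcs G \<Longrightarrow> x \<in> pverts G \<and> y \<in> pverts G"
proof -
  assume "pair_graph G" and xy: "(x, y) \<in> parcs G"
  then interpret pair_graph G by simp
  show ?thesis using arc_fst_in_verts[OF xy] arc_snd_in_verts[OF xy] by simp
qed

lemma pair_graphI:
  assumes "finite (pverts G)" and v: "\<And>x y. (x, y) \<in> parcs G \<Longrightarrow> x \<in> pverts G \<and> y \<in> pverts G"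
    and sym: "\<And>x y. (x, y) \<in> parcs G \<Longrightarrow> (y, x) \<in> parcs G" and irr: "\<And>x. (x, x) \<notin> parcs G"
  shows "pair_graph G"
proof
  have "parcs G \<subseteq> pverts G \<times> pverts G" using v by auto
  then show "finite (parcs G)" using assms(1) by (meson finite_SigmaI finite_subset)
  show "symmetric (with_proj G)"
    unfolding symmetric_def by (rule symI) (use sym in \<open>auto simp: arcs_ends_def arc_to_ends_def\<close>)
qed (use assms in \<open>force+\<close>)

text \<open>A cycle as in \<open>two_chords\<close> has at most the chord between
  \<open>p ! 0\<close> and \<open>p ! (length p - 2)\<close>, whereas the Meyniel condition demands
  two.\<close>

lemma meyniel_rel_parcs:
  assumes "meyniel G" shows "meyniel_rel (\<lambda>x y. (x, y) \<in> parcs G)"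
proof
  have G: "pair_graph G" using assms by (simp add: meyniel_def)
  show "(y, x) \<in> parcs G" if "(x, y) \<in> parcs G" for x y using pair_graph_sym[OF G that] .
  show "(x, x) \<notin> parcs G" for x using pair_graph_irrefl[OF G] .
  fix p assume p: "distinct p" "odd (length p)" "5 \<le> length p"
    and walk: "\<And>i. Suc i < length p \<Longrightarrow> (p ! i, p ! Suc i) \<in> parcs G"
    and close: "(p ! (length p - 1), p ! 0) \<in> parcs G"
    and chord: "\<And>i j. i < j \<Longrightarrow> j < length p \<Longrightarrow> (p ! i, p ! j) \<in> parcs G \<Longrightarrow>
      j = Suc i \<or> i = 0 \<and> (j = length p - 1 \<or> j = length p - 2)"
  have ne: "p \<noteq> []" using p by auto
  have "cycle_arcs p \<subseteq> parcs G"
    using walk close ne by (auto simp: cycle_arcs_conv set_vwalk_arcs last_conv_nth hd_conv_nth)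
  moreover have "set p \<subseteq> pverts G"
  proof
    fix x assume "x \<in> set p"
    then obtain i where i: "i < length p" "x = p ! i" by (auto simp: in_set_conv_nth)
    show "x \<in> pverts G"
    proof (cases "Suc i < length p")
      case True then show ?thesis using pair_graph_verts[OF G walk[OF True]] i by simp
    next
      case False
      then have "i = length p - 1" using i by simp
      then show ?thesis using pair_graph_verts[OF G close] i by simp
    qed
  qed
  ultimately have "2 \<le> card (chords G p)" using assms p by (auto simp: meyniel_def graph_cycle_def)
  moreover have "chords G p \<subseteq> {{p ! 0, p ! (length p - 2)}}"
  proof
    fix c assume "c \<in> chords G p"
    then obtain x y where c: "c = {x, y}" "x \<in> set p" "y \<in> set p" "(x, y) \<in> parcs G"
      "(x, y) \<notin> cycle_arcs p" "(y, x) \<notin> cycle_arcs p" unfolding chords_def by blast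
    obtain i j where ij: "i < length p" "x = p ! i" "j < length p" "y = p ! j"
      using c by (auto simp: in_set_conv_nth)
    have *: "{p ! i, p ! j} = {p ! 0, p ! (length p - 2)}"
      if "i < j" "j < length p" "(p ! i, p ! j) \<in> parcs G" "(p ! i, p ! j) \<notin> cycle_arcs p" "(p ! j, p ! i) \<notin> cycle_arcs p" for i j
      using chord[OF that(1-3)] that cycle_arcs_nth[OF p(1), of i j] cycle_arcs_nth[OF p(1), of j i] by auto
    have "i \<noteq> j" using c(4) ij pair_graph_irrefl[OF G] by auto
    then show "c \<in> {{p ! 0, p ! (length p - 2)}}"
      using *[of i j] *[of j i] ij c pair_graph_sym[OF G c(4)]
      by (cases i j rule: linorder_cases) (auto simp: insert_commute)
  qed
  ultimately have "(2::nat) \<le> 1" using card_mono[of "{{p ! 0, p ! (length p - 2)}}" "chords G p"] by auto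
  then show False by simp
qed

text \<open>The injectivity modulo \<open>n\<close> is for antiholes: nonadjacency in the complement
  means adjacency only for distinct vertices.\<close>

lemma is_hole_cyclic:
  assumes "is_hole K"
  obtains n g where "4 \<le> n" "card (pverts K) = nat n" "range g = pverts K"
    "cyclic_hole (\<lambda>x y. (x, y) \<in> parcs K) n g" "\<And>i j. g i = g j \<longleftrightarrow> (j - i) mod n = 0"
proof -
  have K: "pair_graph K" using assms by (simp add: is_hole_def)
  obtain p where p: "graph_cycle K p" "4 \<le> length p" "pverts K = set p" "chords K p = {}"
    using assms by (auto simp: is_hole_def)
  then have d: "distinct p" and sub: "cycle_arcs p \<subseteq> parcs K" by (auto simp: graph_cycle_def)
  define n where "n = int (length p)"
  define f where "f i = p ! nat i" for i :: int
  have n4: "4 \<le> n" using p by (simp add: n_def)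
  have arcs: "(p ! i, p ! j) \<in> parcs K \<longleftrightarrow> j = Suc i \<or> i = 0 \<and> j = length p - 1" if "i < j" "j < length p" for i j
  proof
    assume e: "(p ! i, p ! j) \<in> parcs K"
    have "(p ! i, p ! j) \<in> cycle_arcs p \<or> (p ! j, p ! i) \<in> cycle_arcs p"
    proof (rule ccontr)
      assume "\<not> ?thesis"
      then have "{p ! i, p ! j} \<in> chords K p" using e that unfolding chords_def by fastforce
      then show False using p(4) by simp
    qed
    then show "j = Suc i \<or> i = 0 \<and> j = length p - 1" using cycle_arcs_nth[OF d] that by auto
  next
    assume "j = Suc i \<or> i = 0 \<and> j = length p - 1"
    then have "(p ! i, p ! j) \<in> cycle_arcs p \<or> (p ! j, p ! i) \<in> cycle_arcs p"
      using cycle_arcs_nth[OF d, of i j] cycle_arcs_nth[OF d, of j i] that by auto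
    then show "(p ! i, p ! j) \<in> parcs K" using sub pair_graph_sym[OF K] by blast
  qed
  have "cyclic_hole (\<lambda>x y. (x, y) \<in> parcs K) n (\<lambda>i. f (i mod n))"
  proof (rule cyclic_holeI)
    show "symp (\<lambda>x y. (x, y) \<in> parcs K)" using pair_graph_sym[OF K] by (auto intro: sympI)
    show "(f a, f b) \<in> parcs K \<longleftrightarrow> b = a + 1 \<or> a = 0 \<and> b = n - 1" if "0 \<le> a" "a < b" "b < n" for a b
      using arcs[of "nat a" "nat b"] that by (auto simp: f_def n_def)
  qed (use n4 pair_graph_irrefl[OF K] in auto)
  moreover have "f (i mod n) = f (j mod n) \<longleftrightarrow> (j - i) mod n = 0" for i j
  proof -
    have "0 \<le> i mod n" "i mod n < n" "0 \<le> j mod n" "j mod n < n" using n4 by auto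
    then have "f (i mod n) = f (j mod n) \<longleftrightarrow> j mod n = i mod n"
      using nth_eq_iff_index_eq[OF d, of "nat (i mod n)" "nat (j mod n)"] by (auto simp: f_def n_def nat_less_iff)
    also have "\<dots> \<longleftrightarrow> (j - i) mod n = 0" by (simp add: mod_eq_dvd_iff mod_eq_0_iff_dvd)
    finally show ?thesis .
  qed
  moreover have "range (\<lambda>i. f (i mod n)) = pverts K"
  proof
    have "nat (i mod n) < length p" for i
      using n4 pos_mod_bound[of n i] pos_mod_sign[of n i] unfolding n_def by linarith
    then show "range (\<lambda>i. f (i mod n)) \<subseteq> pverts K" using p(3) by (auto simp: f_def)
    show "pverts K \<subseteq> range (\<lambda>i. f (i mod n))"
    proof
      fix x assume "x \<in> pverts K"
      then obtain i where "i < length p" "x = p ! i" using p(3) by (auto simp: in_set_conv_nth)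
      then have "x = f (int i mod n)" by (simp add: f_def n_def)
      then show "x \<in> range (\<lambda>i. f (i mod n))" by blast
    qed
  qed
  moreover have "card (pverts K) = nat n" using p(3) d by (simp add: n_def distinct_card)
  ultimately show ?thesis using that n4 by blast
qed

section \<open>Transfer to the co-contracted graph\<close>

lemma prism_arcs_prism:
  assumes d: "distinct (us @ vs @ ws)" and len: "2 \<le> length us" "2 \<le> length vs" "2 \<le> length ws"
  shows "prism (\<lambda>x y. (x, y) \<in> prism_arcs us vs ws \<union> (prism_arcs us vs ws)\<inverse>)
    (\<lambda>i. us ! nat i) (int (length us) - 1) (\<lambda>i. vs ! nat i) (int (length vs) - 1)
    (\<lambda>i. ws ! nat i) (int (length ws) - 1)"
proof -
  have ne: "us \<noteq> []" "vs \<noteq> []" "ws \<noteq> []" using len by auto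
  have disj: "x \<in> set us \<Longrightarrow> x \<notin> set vs" "x \<in> set us \<Longrightarrow> x \<notin> set ws" "x \<in> set vs \<Longrightarrow> x \<notin> set ws"
    "x \<in> set vs \<Longrightarrow> x \<notin> set us" "x \<in> set ws \<Longrightarrow> x \<notin> set us" "x \<in> set ws \<Longrightarrow> x \<notin> set vs" for x
    using d by auto
  have ends: "hd us \<in> set us" "hd vs \<in> set vs" "hd ws \<in> set ws"
    "last us \<in> set us" "last vs \<in> set vs" "last ws \<in> set ws" using ne by auto
  have in_set: "(x, y) \<in> set (vwalk_arcs xs) \<Longrightarrow> x \<in> set xs \<and> y \<in> set xs" for x y and xs :: "'a list"
    by (auto simp: set_vwalk_arcs)
  have mem: "(x, y) \<in> prism_arcs us vs ws \<longleftrightarrow>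
    (x, y) \<in> set (vwalk_arcs us) \<or> (x, y) \<in> set (vwalk_arcs vs) \<or> (x, y) \<in> set (vwalk_arcs ws) \<or>
    x = hd us \<and> y = hd vs \<or> x = hd vs \<and> y = hd ws \<or> x = hd ws \<and> y = hd us \<or>
    x = last us \<and> y = last vs \<or> x = last vs \<and> y = last ws \<or> x = last ws \<and> y = last us" for x y
    by (auto simp: prism_arcs_def triangle_arcs_def)
  have within: "(x, y) \<in> prism_arcs us vs ws \<longleftrightarrow> (x, y) \<in> set (vwalk_arcs xs)"
    if "x \<in> set xs" "y \<in> set xs" "xs \<in> {us, vs, ws}" for x y xs
    using that disj ends in_set[of x y us] in_set[of x y vs] in_set[of x y ws] unfolding mem by blast
  have uv: "(x, y) \<in> prism_arcs us vs ws \<longleftrightarrow> x = hd us \<and> y = hd vs \<or> x = last us \<and> y = last vs"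
    "(y, x) \<notin> prism_arcs us vs ws" if "x \<in> set us" "y \<in> set vs" for x y
    using that disj ends in_set[of x y] in_set[of y x] unfolding mem by blast+
  have vw: "(x, y) \<in> prism_arcs us vs ws \<longleftrightarrow> x = hd vs \<and> y = hd ws \<or> x = last vs \<and> y = last ws"
    "(y, x) \<notin> prism_arcs us vs ws" if "x \<in> set vs" "y \<in> set ws" for x y
    using that disj ends in_set[of x y] in_set[of y x] unfolding mem by blast+
  \<comment> \<open>\<open>triangle_arcs\<close> is oriented cyclically, so its arcs between the
    outer two paths go from \<open>ws\<close> to \<open>us\<close>.\<close>
  have uw: "(y, x) \<in> prism_arcs us vs ws \<longleftrightarrow> x = hd us \<and> y = hd ws \<or> x = last us \<and> y = last ws"
    "(x, y) \<notin> prism_arcs us vs ws" if "x \<in> set us" "y \<in> set ws" for x y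
    using that disj ends in_set[of x y] in_set[of y x] unfolding mem by blast+
  have walk: "(xs ! i, xs ! j) \<in> set (vwalk_arcs xs) \<longleftrightarrow> j = Suc i"
    if "distinct xs" "i < length xs" "j < length xs" for i j and xs :: "'a list"
    using that unfolding set_vwalk_arcs by (auto simp: nth_eq_iff_index_eq)
  have path: "ipath (\<lambda>x y. (x, y) \<in> prism_arcs us vs ws \<union> (prism_arcs us vs ws)\<inverse>) (\<lambda>i. xs ! nat i) (int (length xs) - 1 + 1)"
    if xs: "xs \<in> {us, vs, ws}" for xs
    unfolding ipath_def
  proof (intro allI impI)
    fix i j assume ij: "0 \<le> i \<and> i < j \<and> j < int (length xs) - 1 + 1"
    have "distinct xs" using xs d by auto
    then show "(xs ! nat i, xs ! nat j) \<in> prism_arcs us vs ws \<union> (prism_arcs us vs ws)\<inverse> \<longleftrightarrow> j = i + 1"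
      using ij within[of "xs ! nat i" xs "xs ! nat j"] within[of "xs ! nat j" xs "xs ! nat i"] xs
        walk[of xs "nat i" "nat j"] walk[of xs "nat j" "nat i"] by auto
  qed
  have hd: "xs ! nat i = hd xs \<longleftrightarrow> i = 0" and last: "xs ! nat i = last xs \<longleftrightarrow> i = int (length xs) - 1"
    if "i \<in> {0..int (length xs) - 1}" "xs \<in> {us, vs, ws}" for i xs
  proof -
    have "distinct xs" "xs \<noteq> []" "nat i < length xs" using that d ne by auto
    then show "xs ! nat i = hd xs \<longleftrightarrow> i = 0" "xs ! nat i = last xs \<longleftrightarrow> i = int (length xs) - 1"
      using that by (auto simp: hd_conv_nth last_conv_nth nth_eq_iff_index_eq)
  qed
  have mem_set: "xs ! nat i \<in> set xs" if "i \<in> {0..int (length xs) - 1}" "xs \<in> {us, vs, ws}" for i xs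
    using that ne by auto
  show ?thesis
    unfolding prism_def
    using len path[of us] path[of vs] path[of ws] uv[OF mem_set mem_set] vw[OF mem_set mem_set] uw[OF mem_set mem_set]
    by (auto simp: hd last)
qed

lemma prism_transfer:
  assumes pr: "prism R u r v s w t" and V: "prism_verts u r v s w t \<subseteq> W"
    and eq: "\<And>x y. x \<in> W \<Longrightarrow> y \<in> W \<Longrightarrow> R x y \<longleftrightarrow> A x y"
  shows "prism A u r v s w t"
proof -
  have mem: "\<And>i. 0 \<le> i \<Longrightarrow> i \<le> r \<Longrightarrow> u i \<in> W" "\<And>i. 0 \<le> i \<Longrightarrow> i \<le> s \<Longrightarrow> v i \<in> W"
    "\<And>i. 0 \<le> i \<Longrightarrow> i \<le> t \<Longrightarrow> w i \<in> W" using V by (auto simp: prism_verts_def)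
  have "ipath A u (r + 1)" "ipath A v (s + 1)" "ipath A w (t + 1)"
    using prismD(10-12)[OF pr] mem eq unfolding ipath_def by auto
  then show ?thesis using pr mem eq unfolding prism_def by auto
qed

lemma induced_subgraph_parcs:
  assumes "induced_subgraph (with_proj K) (with_proj H)"
  shows "pverts K \<subseteq> pverts H" "\<And>x y. x \<in> pverts K \<Longrightarrow> y \<in> pverts K \<Longrightarrow> (x, y) \<in> parcs K \<longleftrightarrow> (x, y) \<in> parcs H"
  using assms unfolding induced_subgraph_def subgraph_def by auto

context
  fixes G :: "'a pair_pre_digraph" and Q :: "'a set set"
  assumes G: "pair_graph G" and Q: "\<And>C. C \<in> Q \<Longrightarrow> C \<subseteq> pverts G"
begin

lemma finite_pverts: "finite (pverts G)"
  using G pair_fin_digraph.pair_finite_verts pair_graph.axioms(1) pair_digraph.axioms(1) by blast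

text \<open>The finiteness built into \<open>contract_adj\<close> is automatic here, as the
  contracted sets are subsets of the finite vertex set.\<close>

lemma co_contract_adj:
  assumes "x \<in> pverts (co_contract G Q)" "y \<in> pverts (co_contract G Q)"
  shows "(x, y) \<in> parcs (co_contract G Q) \<longleftrightarrow> contract_adj (\<lambda>x y. (x, y) \<in> parcs G) x y"
  using assms Q finite_subset[OF _ finite_pverts] pair_graph_sym[OF G]
  by (cases x; cases y) (auto simp: co_contract_def)

lemma pair_graph_co_contract: "pair_graph (co_contract G Q)"
proof (rule pair_graphI)
  have "Q \<subseteq> Pow (pverts G)" using Q by auto
  then have "finite Q" using finite_pverts by (meson finite_Pow_iff finite_subset)
  then show "finite (pverts (co_contract G Q))" using finite_pverts by (simp add: co_contract_def)
qed (use pair_graph_sym[OF G] pair_graph_irrefl[OF G] in \<open>auto simp: co_contract_def\<close>)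

end

theorem theorem2:
  fixes G :: "'a pair_pre_digraph" and Q :: "'a set set"
  assumes "meyniel G" and "pre_co_coloring G Q"
  shows "artemis (co_contract G Q)"
proof -
  have G: "pair_graph G" using assms(1) by (simp add: meyniel_def)
  have Q: "C \<subseteq> pverts G" if "C \<in> Q" for C using assms(2) that by (auto simp: pre_co_coloring_def clique_def)
  interpret meyniel_rel "\<lambda>x y. (x, y) \<in> parcs G" by (rule meyniel_rel_parcs[OF assms(1)])
  have adj: "pverts K \<subseteq> pverts (co_contract G Q)" "\<And>x y. x \<in> pverts K \<Longrightarrow> y \<in> pverts K \<Longrightarrow> (x, y) \<in> parcs K \<longleftrightarrow> A x y"
    if "induced_subgraph (with_proj K) (with_proj (co_contract G Q))" for K
    using induced_subgraph_parcs[OF that] co_contract_adj[OF G Q] by blast+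
  have "\<not> is_odd_hole K" if ind: "induced_subgraph (with_proj K) (with_proj (co_contract G Q))" for K
  proof
    assume "is_odd_hole K"
    then have K: "is_hole K" "odd (card (pverts K))" by (auto simp: is_odd_hole_def)
    obtain n g where n: "4 \<le> n" "card (pverts K) = nat n" "range g = pverts K"
      and hole: "cyclic_hole (\<lambda>x y. (x, y) \<in> parcs K) n g"
      using is_hole_cyclic[OF K(1)] by metis
    have A_g: "A (g i) (g j) \<longleftrightarrow> (j - i) mod n = 1 \<or> (i - j) mod n = 1" for i j
      using hole adj(2)[OF ind, of "g i" "g j"] n(3) unfolding cyclic_hole_def by blast
    have lt: "A (g i) (g j) \<longleftrightarrow> j = i + 1 \<or> i = 0 \<and> j = n - 1" if "0 \<le> i" "i < j" "j < n" for i j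
      using A_g[of i j] cyclic_adjacent_iff[of n i j] that n(1) by simp
    have "odd n" using K(2) n(1,2) by (simp add: even_nat_iff)
    then have "5 \<le> n" using n(1) by presburger
    then have "odd_hole A (g 0) (\<lambda>i. g (i + 1)) (n - 1)"
      using lt \<open>odd n\<close> unfolding odd_hole_def ipath_def by auto
    then show False using no_odd_hole by blast
  qed
  moreover have "\<not> (is_antihole K \<and> 5 \<le> card (pverts K))"
    if ind: "induced_subgraph (with_proj K) (with_proj (co_contract G Q))" for K
  proof
    assume K: "is_antihole K \<and> 5 \<le> card (pverts K)"
    then have "is_hole (complement_graph K)" by (simp add: is_antihole_def)
    then obtain n g where n: "card (pverts (complement_graph K)) = nat n" "range g = pverts (complement_graph K)"
      and hole: "cyclic_hole (\<lambda>x y. (x, y) \<in> parcs (complement_graph K)) n g"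
      and inj: "\<And>i j. g i = g j \<longleftrightarrow> (j - i) mod n = 0"
      using is_hole_cyclic by metis
    have n5: "5 \<le> n" and range: "range g = pverts K" using K n by (auto simp: complement_graph_def)
    have "A (g i) (g j) \<longleftrightarrow> (j - i) mod n \<notin> {0, 1, n - 1}" for i j
    proof -
      have gi: "g i \<in> pverts K" "g j \<in> pverts K" using range by auto
      have "(i - j) mod n = 1 \<longleftrightarrow> (j - i) mod n = n - 1"
        using zmod_zminus1_eq_if[of "j - i" n] n5 by auto
      moreover have "(g i, g j) \<in> parcs (complement_graph K) \<longleftrightarrow> (j - i) mod n = 1 \<or> (i - j) mod n = 1"
        using hole unfolding cyclic_hole_def by auto
      ultimately have "g i \<noteq> g j \<and> (g i, g j) \<notin> parcs K \<longleftrightarrow> (j - i) mod n = 1 \<or> (j - i) mod n = n - 1"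
        using gi by (simp add: complement_graph_def)
      moreover have "\<not> A (g i) (g j)" if "g i = g j" using A_irrefl that by simp
      ultimately show ?thesis using inj[of i j] adj(2)[OF ind gi] n5 by auto
    qed
    then show False using no_antihole[OF n5] by blast
  qed
  moreover have "\<not> is_prism K" if ind: "induced_subgraph (with_proj K) (with_proj (co_contract G Q))" for K
  proof
    assume "is_prism K"
    then obtain us vs ws where len: "2 \<le> length us" "2 \<le> length vs" "2 \<le> length ws"
      and d: "distinct (us @ vs @ ws)" and V: "pverts K = set us \<union> set vs \<union> set ws"
      and R: "parcs K = prism_arcs us vs ws \<union> (prism_arcs us vs ws)\<inverse>"
      unfolding is_prism_def by blast
    have "xs ! nat i \<in> set xs" if "xs \<in> {us, vs, ws}" "i \<in> {0..int (length xs) - 1}" for xs i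
      using that len by auto
    then have "prism A (\<lambda>i. us ! nat i) (int (length us) - 1) (\<lambda>i. vs ! nat i) (int (length vs) - 1)
      (\<lambda>i. ws ! nat i) (int (length ws) - 1)"
      by (intro prism_transfer[OF prism_arcs_prism[OF d len], of "pverts K"])
        (auto simp: V prism_verts_def adj(2)[OF ind, unfolded V] R[symmetric])
    then show False using no_prism by blast
  qed
  ultimately show ?thesis
    using pair_graph_co_contract[OF G Q] by (auto simp: artemis_def contains_induced_def)
qed

end
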